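(* Let $p,q\in\mathbb C$ with $p\ne q$, and let $$S=\begin{bmatrix}1&0&0&p\\0&0&1&0\\0&1&0&0\\0&0&0&-1\end{bmatrix},\qquad R=\begin{bmatrix}1&0&0&q\\0&0&1&0\\0&1&0&0\\0&0&0&-1\end{bmatrix}.$$ Let $\rho_n$ be the representation of the mixed doubles group $\mathsf{MD}_n$ on $(\mathbb C^2)^{\otimes n}$ given by $r_i\mapsto I_2^{\otimes(i-1)}\otimes R\otimes I_2^{\otimes(n-i-1)}$, $s_i\mapsto I_2^{\otimes(i-1)}\otimes S\otimes I_2^{\otimes(n-i-1)}$. Then for every $n\ge3$ the representation $\rho_n$ decomposes as the direct sum of two indecomposable representations of dimension $2^{n-1}$.
   Context: For $n\in\mathbb N$ the mixed doubles group $\mathsf{MD}_n$ is the group with generators $s_1,\dots,s_{n-1},r_1,\dots,r_{n-1}$ and relations $r_ir_{i+1}r_i=r_{i+1}r_ir_{i+1}$, $r_ir_{i+1}s_i=s_{i+1}r_ir_{i+1}$, $r_is_{i+1}s_i=s_{i+1}s_ir_{i+1}$, $s_is_{i+1}s_i=s_{i+1}s_is_{i+1}$, $s_i^2=1$, $r_i^2=1$, and $r_ir_j=r_jr_i$, $s_is_j=s_js_i$, $r_is_j=s_jr_i$ for $|i-j|>1$. The given pair $(R,S)$ does define a representation of $\mathsf{MD}_n$ by the stated formula for every $n$. *)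

theory Defs
  imports
    "Jordan_Normal_Form.VS_Connect"
begin

section \<open>Groups given by generators and relations\<close>

text \<open>A word is a list of pairs \<open>(x, e)\<close>; the letter \<open>(x, True)\<close> stands for the generator \<open>x\<close>
  and \<open>(x, False)\<close> for its formal inverse.  A pair \<open>(l, r)\<close> of words in the set \<open>Q\<close> is the
  relation \<open>l = r\<close>; pairs that are not words over the generating set \<open>X\<close> are ignored.\<close>

type_synonym 'g word = "('g \<times> bool) list"

definition words :: "'g set \<Rightarrow> 'g word set" where
  "words X = lists (X \<times> UNIV)"

inductive_set word_cong :: "'g set \<Rightarrow> ('g word \<times> 'g word) set \<Rightarrow> ('g word \<times> 'g word) set"
  for X Q where
  refl: "u \<in> words X \<Longrightarrow> (u, u) \<in> word_cong X Q"
| sym: "(u, v) \<in> word_cong X Q \<Longrightarrow> (v, u) \<in> word_cong X Q"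
| trans: "(u, v) \<in> word_cong X Q \<Longrightarrow> (v, w) \<in> word_cong X Q \<Longrightarrow> (u, w) \<in> word_cong X Q"
| cancel: "u \<in> words X \<Longrightarrow> v \<in> words X \<Longrightarrow> x \<in> X \<Longrightarrow>
    (u @ [(x, e), (x, \<not> e)] @ v, u @ v) \<in> word_cong X Q"
| rel: "u \<in> words X \<Longrightarrow> v \<in> words X \<Longrightarrow> (l, r) \<in> Q \<Longrightarrow> l \<in> words X \<Longrightarrow> r \<in> words X \<Longrightarrow>
    (u @ l @ v, u @ r @ v) \<in> word_cong X Q"

definition word_class :: "'g set \<Rightarrow> ('g word \<times> 'g word) set \<Rightarrow> 'g word \<Rightarrow> 'g word set" where
  "word_class X Q w = word_cong X Q `` {w}"

definition presented_group :: "'g set \<Rightarrow> ('g word \<times> 'g word) set \<Rightarrow> 'g word set monoid" where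
  "presented_group X Q =
    \<lparr>carrier = words X // word_cong X Q,
     mult = (\<lambda>A B. \<Union>a\<in>A. \<Union>b\<in>B. word_class X Q (a @ b)),
     one = word_class X Q []\<rparr>"

lemma words_simps [simp]:
  "[] \<in> words X" "(x, e) # w \<in> words X \<longleftrightarrow> x \<in> X \<and> w \<in> words X"
  "u @ v \<in> words X \<longleftrightarrow> u \<in> words X \<and> v \<in> words X"
  by (auto simp: words_def)

lemma word_congD: "(u, v) \<in> word_cong X Q \<Longrightarrow> u \<in> words X \<and> v \<in> words X"
  by (induction rule: word_cong.induct) (auto)

lemma equiv_word_cong: "equiv (words X) (word_cong X Q)"
proof (rule equivI)
  show "word_cong X Q \<subseteq> words X \<times> words X" using word_congD[of _ _ X Q] by fast
qed (auto intro!: refl_onI symI transI intro: word_cong.intros)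

lemma word_cong_context:
  assumes "(u, v) \<in> word_cong X Q" "a \<in> words X" "b \<in> words X"
  shows "(a @ u @ b, a @ v @ b) \<in> word_cong X Q"
  using assms(1)
proof induction
  case (refl u)
  then show ?case using assms by (intro word_cong.refl) auto
next
  case (cancel u v x e)
  then show ?case using word_cong.cancel[of "a @ u" X "v @ b" x e Q] assms by auto
next
  case (rel u v l r)
  then show ?case using word_cong.rel[of "a @ u" X "v @ b" l r Q] assms by auto
qed (blast intro: word_cong.intros)+

lemma word_cong_append:
  assumes "(a, a') \<in> word_cong X Q" "(b, b') \<in> word_cong X Q"
  shows "(a @ b, a' @ b') \<in> word_cong X Q"
  using word_cong_context[OF assms(1), of "[]" b] word_cong_context[OF assms(2), of a' "[]"]
    word_congD[OF assms(1)] word_congD[OF assms(2)]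
  by (auto intro: word_cong.trans)

lemma word_class_eqI: "(u, v) \<in> word_cong X Q \<Longrightarrow> word_class X Q u = word_class X Q v"
  unfolding word_class_def by (rule equiv_class_eq[OF equiv_word_cong])

lemma presented_group_carrierE:
  assumes "A \<in> carrier (presented_group X Q)"
  obtains a where "a \<in> words X" "A = word_class X Q a"
  using assms unfolding presented_group_def word_class_def
  by (auto elim!: quotientE)

lemma word_class_carrier: "a \<in> words X \<Longrightarrow> word_class X Q a \<in> carrier (presented_group X Q)"
  by (auto simp: presented_group_def word_class_def intro: quotientI)

lemma presented_group_mult:
  assumes "a \<in> words X" "b \<in> words X"
  shows "word_class X Q a \<otimes>\<^bsub>presented_group X Q\<^esub> word_class X Q b = word_class X Q (a @ b)"
proof -
  have "word_class X Q (a' @ b') = word_class X Q (a @ b)"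
    if "a' \<in> word_class X Q a" "b' \<in> word_class X Q b" for a' b'
    using that word_cong_append[of a a' X Q b b'] word_class_eqI[of "a @ b" "a' @ b'" X Q]
    by (simp add: word_class_def)
  moreover have "a \<in> word_class X Q a" "b \<in> word_class X Q b"
    using assms by (auto simp: word_class_def intro: word_cong.refl)
  ultimately have "(\<Union>a'\<in>word_class X Q a. \<Union>b'\<in>word_class X Q b. word_class X Q (a' @ b')) =
      word_class X Q (a @ b)"
    by blast
  then show ?thesis by (simp add: presented_group_def)
qed

lemma presented_group_one: "\<one>\<^bsub>presented_group X Q\<^esub> = word_class X Q []"
  by (simp add: presented_group_def)

lemma word_inverse:
  assumes "w \<in> words X"
  shows "(map (\<lambda>(x, e). (x, \<not> e)) (rev w) @ w, []) \<in> word_cong X Q"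
  using assms
proof (induction w)
  case (Cons y w)
  obtain x e where y: "y = (x, e)" by force
  let ?i = "\<lambda>w. map (\<lambda>(x, e). (x, \<not> e)) (rev w)"
  have w: "w \<in> words X" "x \<in> X" using Cons.prems y by simp_all
  moreover have "?i w \<in> words X" using w(1) by (auto simp: words_def)
  ultimately have "(?i w @ [(x, \<not> e), (x, \<not> \<not> e)] @ w, ?i w @ w) \<in> word_cong X Q"
    by (intro word_cong.cancel)
  with Cons y show ?case by (auto intro: word_cong.trans)
qed (auto intro: word_cong.refl)

lemma group_presented_group: "group (presented_group X Q)"
proof (rule groupI)
  fix A assume "A \<in> carrier (presented_group X Q)"
  then obtain a where a: "a \<in> words X" "A = word_class X Q a"
    by (rule presented_group_carrierE)
  let ?i = "map (\<lambda>(x, e). (x, \<not> e)) (rev a)"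
  have i: "?i \<in> words X" using a(1) by (auto simp: words_def)
  then have "word_class X Q ?i \<otimes>\<^bsub>presented_group X Q\<^esub> A = \<one>\<^bsub>presented_group X Q\<^esub>"
    using a word_class_eqI[OF word_inverse[OF a(1)]]
    by (simp add: presented_group_mult presented_group_one)
  with i show "\<exists>B\<in>carrier (presented_group X Q).
      B \<otimes>\<^bsub>presented_group X Q\<^esub> A = \<one>\<^bsub>presented_group X Q\<^esub>"
    using word_class_carrier by blast
qed (auto elim!: presented_group_carrierE
      simp: presented_group_mult presented_group_one
      intro!: word_class_carrier)

definition word_eval :: "('h, 'b) monoid_scheme \<Rightarrow> ('g \<Rightarrow> 'h) \<Rightarrow> 'g word \<Rightarrow> 'h" where
  "word_eval H f w =
    foldr (\<lambda>(x, e) h. (if e then f x else inv\<^bsub>H\<^esub> (f x)) \<otimes>\<^bsub>H\<^esub> h) w \<one>\<^bsub>H\<^esub>"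

lemma (in group) word_eval_simps:
  "word_eval G f [] = \<one>"
  "word_eval G f ((x, e) # w) = (if e then f x else inv (f x)) \<otimes> word_eval G f w"
  by (simp_all add: word_eval_def)

lemma (in group) word_eval_closed:
  "f \<in> X \<rightarrow> carrier G \<Longrightarrow> w \<in> words X \<Longrightarrow> word_eval G f w \<in> carrier G"
proof (induction w)
  case (Cons y w)
  then show ?case by (cases y) (auto simp: word_eval_simps Pi_iff)
qed (simp add: word_eval_simps)

lemma (in group) word_eval_append:
  "f \<in> X \<rightarrow> carrier G \<Longrightarrow> u \<in> words X \<Longrightarrow> v \<in> words X \<Longrightarrow>
    word_eval G f (u @ v) = word_eval G f u \<otimes> word_eval G f v"
proof (induction u)
  case (Cons y u)
  then show ?case using word_eval_closed[of f X]
    by (cases y) (auto simp: word_eval_simps Pi_iff m_assoc)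
qed (simp add: word_eval_simps word_eval_closed)

lemma (in group) word_eval_cong:
  assumes f: "f \<in> X \<rightarrow> carrier G"
    and Q: "\<And>l r. (l, r) \<in> Q \<Longrightarrow> word_eval G f l = word_eval G f r"
    and uv: "(u, v) \<in> word_cong X Q"
  shows "word_eval G f u = word_eval G f v"
  using uv
proof induction
  case (cancel u v x e)
  have [simp]: "f x \<in> carrier G" using f cancel by auto
  have "word_eval G f [(x, e), (x, \<not> e)] = \<one>" by (simp add: word_eval_simps)
  moreover have "[(x, e), (x, \<not> e)] \<in> words X" using cancel by auto
  ultimately show ?case using cancel word_eval_closed[OF f]
    by (simp add: word_eval_append[OF f] del: append_Cons append_Nil)
next
  case (rel u v l r)
  then show ?case using Q[OF rel(3)] by (simp add: word_eval_append[OF f])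
qed auto

lemma presented_group_hom_exists:
  assumes H: "group H" and f: "f \<in> X \<rightarrow> carrier H"
    and Q: "\<And>l r. (l, r) \<in> Q \<Longrightarrow> word_eval H f l = word_eval H f r"
  shows "\<exists>\<phi>. group_hom (presented_group X Q) H \<phi> \<and>
    (\<forall>x\<in>X. \<phi> (word_class X Q [(x, True)]) = f x)"
proof -
  interpret H: group H by fact
  define \<phi> where "\<phi> A = word_eval H f (SOME a. a \<in> A)" for A
  have \<phi>: "\<phi> (word_class X Q a) = word_eval H f a" if "a \<in> words X" for a
  proof -
    have "a \<in> word_class X Q a" using that by (auto simp: word_class_def intro: word_cong.refl)
    then have "(SOME b. b \<in> word_class X Q a) \<in> word_class X Q a" by (rule someI)
    then show ?thesis unfolding \<phi>_def
      using H.word_eval_cong[OF f Q] by (simp add: word_class_def)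
  qed
  have "\<phi> \<in> hom (presented_group X Q) H"
    by (rule homI)
      (auto elim!: presented_group_carrierE
        simp: \<phi> presented_group_mult H.word_eval_append[OF f]
        intro: H.word_eval_closed[OF f])
  moreover have "\<phi> (word_class X Q [(x, True)]) = f x" if "x \<in> X" for x
    using that f by (auto simp: \<phi> H.word_eval_simps Pi_iff)
  ultimately show ?thesis
    using H group_presented_group by (auto simp: group_hom_def group_hom_axioms_def)
qed

section \<open>The mixed doubles group\<close>

datatype md_gen = Sgen nat | Rgen nat

definition md_gens :: "nat \<Rightarrow> md_gen set" where
  "md_gens n = Sgen ` {1..<n} \<union> Rgen ` {1..<n}"

abbreviation s_letter :: "nat \<Rightarrow> md_gen \<times> bool" where "s_letter i \<equiv> (Sgen i, True)"
abbreviation r_letter :: "nat \<Rightarrow> md_gen \<times> bool" where "r_letter i \<equiv> (Rgen i, True)"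

inductive_set md_rels :: "nat \<Rightarrow> (md_gen word \<times> md_gen word) set" for n where
  rrr: "1 \<le> i \<Longrightarrow> i + 1 < n \<Longrightarrow>
    ([r_letter i, r_letter (i+1), r_letter i],
     [r_letter (i+1), r_letter i, r_letter (i+1)]) \<in> md_rels n"
| rrs: "1 \<le> i \<Longrightarrow> i + 1 < n \<Longrightarrow>
    ([r_letter i, r_letter (i+1), s_letter i],
     [s_letter (i+1), r_letter i, r_letter (i+1)]) \<in> md_rels n"
| rss: "1 \<le> i \<Longrightarrow> i + 1 < n \<Longrightarrow>
    ([r_letter i, s_letter (i+1), s_letter i],
     [s_letter (i+1), s_letter i, r_letter (i+1)]) \<in> md_rels n"
| sss: "1 \<le> i \<Longrightarrow> i + 1 < n \<Longrightarrow>
    ([s_letter i, s_letter (i+1), s_letter i],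
     [s_letter (i+1), s_letter i, s_letter (i+1)]) \<in> md_rels n"
| s_sq: "i \<in> {1..<n} \<Longrightarrow> ([s_letter i, s_letter i], []) \<in> md_rels n"
| r_sq: "i \<in> {1..<n} \<Longrightarrow> ([r_letter i, r_letter i], []) \<in> md_rels n"
| rr_comm: "i \<in> {1..<n} \<Longrightarrow> j \<in> {1..<n} \<Longrightarrow> \<bar>int i - int j\<bar> > 1 \<Longrightarrow>
    ([r_letter i, r_letter j], [r_letter j, r_letter i]) \<in> md_rels n"
| ss_comm: "i \<in> {1..<n} \<Longrightarrow> j \<in> {1..<n} \<Longrightarrow> \<bar>int i - int j\<bar> > 1 \<Longrightarrow>
    ([s_letter i, s_letter j], [s_letter j, s_letter i]) \<in> md_rels n"
| rs_comm: "i \<in> {1..<n} \<Longrightarrow> j \<in> {1..<n} \<Longrightarrow> \<bar>int i - int j\<bar> > 1 \<Longrightarrow>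
    ([r_letter i, s_letter j], [s_letter j, r_letter i]) \<in> md_rels n"

definition MD :: "nat \<Rightarrow> md_gen word set monoid" where
  "MD n = presented_group (md_gens n) (md_rels n)"

definition md_s :: "nat \<Rightarrow> nat \<Rightarrow> md_gen word set" where
  "md_s n i = word_class (md_gens n) (md_rels n) [s_letter i]"

definition md_r :: "nat \<Rightarrow> nat \<Rightarrow> md_gen word set" where
  "md_r n i = word_class (md_gens n) (md_rels n) [r_letter i]"

section \<open>Matrix representations\<close>

abbreviation GL :: "nat \<Rightarrow> complex mat monoid" where
  "GL d \<equiv> units_of (ring_mat TYPE(complex) d ())"

text \<open>A representation of \<open>G\<close> on the space \<open>carrier_vec d\<close> of complex column vectors.\<close>

definition is_representation ::
    "('g, 'b) monoid_scheme \<Rightarrow> nat \<Rightarrow> ('g \<Rightarrow> complex mat) \<Rightarrow> bool" where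
  "is_representation G d \<rho> \<longleftrightarrow> group_hom G (GL d) \<rho>"

definition is_subrepresentation ::
    "('g, 'b) monoid_scheme \<Rightarrow> nat \<Rightarrow> ('g \<Rightarrow> complex mat) \<Rightarrow> complex vec set \<Rightarrow> bool" where
  "is_subrepresentation G d \<rho> W \<longleftrightarrow>
    subspace class_ring W (module_vec TYPE(complex) d) \<and>
    (\<forall>g\<in>carrier G. \<forall>w\<in>W. \<rho> g *\<^sub>v w \<in> W)"

definition is_direct_sum ::
    "nat \<Rightarrow> complex vec set \<Rightarrow> complex vec set \<Rightarrow> complex vec set \<Rightarrow> bool" where
  "is_direct_sum d W A B \<longleftrightarrow> W = {a + b | a b. a \<in> A \<and> b \<in> B} \<and> A \<inter> B = {0\<^sub>v d}"

definition is_indecomposable ::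
    "('g, 'b) monoid_scheme \<Rightarrow> nat \<Rightarrow> ('g \<Rightarrow> complex mat) \<Rightarrow> complex vec set \<Rightarrow> bool" where
  "is_indecomposable G d \<rho> W \<longleftrightarrow>
    is_subrepresentation G d \<rho> W \<and> W \<noteq> {0\<^sub>v d} \<and>
    (\<forall>A B. is_subrepresentation G d \<rho> A \<and> is_subrepresentation G d \<rho> B \<and> is_direct_sum d W A B
       \<longrightarrow> A = {0\<^sub>v d} \<or> B = {0\<^sub>v d})"

definition subspace_dim :: "nat \<Rightarrow> complex vec set \<Rightarrow> nat" where
  "subspace_dim d W = vectorspace.dim class_ring (module_vec TYPE(complex) d\<lparr>carrier := W\<rparr>)"

section \<open>Tensor products of matrices\<close>

text \<open>The Kronecker product is the matrix of the tensor product of two linear maps in the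
  lexicographically ordered product basis.  In particular \<open>(\<complex>\<^sup>2)\<^sup>\<otimes>\<^sup>n\<close> is \<open>carrier_vec (2 ^ n)\<close>.\<close>

definition kron :: "'a :: semiring_1 mat \<Rightarrow> 'a mat \<Rightarrow> 'a mat" (infixl "\<otimes>\<^sub>m" 70) where
  "A \<otimes>\<^sub>m B = mat (dim_row A * dim_row B) (dim_col A * dim_col B)
    (\<lambda>(i, j). A $$ (i div dim_row B, j div dim_col B) * B $$ (i mod dim_row B, j mod dim_col B))"

primrec kron_power :: "'a :: semiring_1 mat \<Rightarrow> nat \<Rightarrow> 'a mat" where
  "kron_power A 0 = 1\<^sub>m 1"
| "kron_power A (Suc k) = A \<otimes>\<^sub>m kron_power A k"

definition local_op :: "nat \<Rightarrow> complex mat \<Rightarrow> nat \<Rightarrow> complex mat" where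
  "local_op n A i = kron_power (1\<^sub>m 2) (i - 1) \<otimes>\<^sub>m A \<otimes>\<^sub>m kron_power (1\<^sub>m 2) (n - i - 1)"

definition braid_mat :: "complex \<Rightarrow> complex mat" where
  "braid_mat a = mat_of_rows_list 4
    [[1, 0, 0,  a],
     [0, 0, 1,  0],
     [0, 1, 0,  0],
     [0, 0, 0, -1]]"

text \<open>The representation \<open>\<rho>\<^sub>n\<close>: the matrix \<open>S\<close> is \<open>braid_mat p\<close> and \<open>R\<close> is \<open>braid_mat q\<close>.
  The conditions determine \<open>\<rho>\<close> on all of \<open>MD n\<close>, since the \<open>s\<^sub>i\<close> and \<open>r\<^sub>i\<close> generate it.\<close>

definition is_md_rep ::
    "nat \<Rightarrow> complex \<Rightarrow> complex \<Rightarrow> (md_gen word set \<Rightarrow> complex mat) \<Rightarrow> bool" where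
  "is_md_rep n p q \<rho> \<longleftrightarrow>
    is_representation (MD n) (2 ^ n) \<rho> \<and>
    (\<forall>i\<in>{1..<n}. \<rho> (md_r n i) = local_op n (braid_mat q) i \<and>
                  \<rho> (md_s n i) = local_op n (braid_mat p) i)"

subsection \<open>Existence of the representation\<close>

lemma kron_dim [simp]:
  "dim_row (A \<otimes>\<^sub>m B) = dim_row A * dim_row B" "dim_col (A \<otimes>\<^sub>m B) = dim_col A * dim_col B"
  by (simp_all add: kron_def)

lemma kron_index:
  "i < dim_row A * dim_row B \<Longrightarrow> j < dim_col A * dim_col B \<Longrightarrow>
    (A \<otimes>\<^sub>m B) $$ (i, j) =
      A $$ (i div dim_row B, j div dim_col B) * B $$ (i mod dim_row B, j mod dim_col B)"
  by (simp add: kron_def)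

lemma div_mod_less:
  fixes i m n :: nat
  assumes "i < m * n"
  shows "i div n < m" "i mod n < n"
proof -
  have "n > 0" using assms by (cases n) auto
  then show "i div n < m" "i mod n < n"
    using assms by (simp_all add: less_mult_imp_div_less)
qed

lemma kron_assoc: "A \<otimes>\<^sub>m B \<otimes>\<^sub>m C = A \<otimes>\<^sub>m (B \<otimes>\<^sub>m C)"
proof (rule eq_matI, goal_cases)
  case (1 i j)
  then have ij: "i < dim_row A * (dim_row B * dim_row C)" "j < dim_col A * (dim_col B * dim_col C)"
    by simp_all
  have ij': "i < (dim_row A * dim_row B) * dim_row C" "j < (dim_col A * dim_col B) * dim_col C"
    using ij by (simp_all add: mult.assoc)
  note d = div_mod_less[OF ij(1)] div_mod_less[OF ij(2)] div_mod_less[OF ij'(1)] div_mod_less[OF ij'(2)]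
  have e: "i mod (b * c) div c = i div c mod b" "i mod (b * c) mod c = i mod c"
    "i div (b * c) = i div c div b" for i b c :: nat
    by (cases "c = 0"; simp add: mult.commute[of b c] mod_mult2_eq div_mult2_eq)+
  show ?case
    using d ij ij' by (simp add: kron_index e mult.assoc)
qed (simp_all add: mult.assoc)

lemma sum_div_mod:
  fixes f :: "nat \<Rightarrow> nat \<Rightarrow> 'a :: comm_monoid_add"
  shows "(\<Sum>k<m * n. f (k div n) (k mod n)) = (\<Sum>i<m. \<Sum>j<n. f i j)"
proof -
  have "(\<Sum>k<m * n. f (k div n) (k mod n)) =
      (\<Sum>i<m. \<Sum>k = i * n..<i * n + n. f (k div n) (k mod n))"
    by (rule sum.nat_group[symmetric])
  also have "\<dots> = (\<Sum>i<m. \<Sum>j<n. f i j)"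
  proof (rule sum.cong[OF HOL.refl])
    fix i
    have "(\<Sum>k = i * n..<i * n + n. f (k div n) (k mod n)) =
        (\<Sum>j = 0..<n. f ((j + i * n) div n) ((j + i * n) mod n))"
      using sum.shift_bounds_nat_ivl[of "\<lambda>k. f (k div n) (k mod n)" 0 "i * n" n]
      by (simp only: add_0 add.commute[of n])
    also have "\<dots> = (\<Sum>j<n. f i j)"
      by (rule sum.cong) auto
    finally show "(\<Sum>k = i * n..<i * n + n. f (k div n) (k mod n)) = (\<Sum>j<n. f i j)" .
  qed
  finally show ?thesis .
qed

lemma kron_mult:
  fixes A B C D :: "'a :: comm_semiring_1 mat"
  assumes "dim_col A = dim_row C" "dim_col B = dim_row D"
  shows "(A \<otimes>\<^sub>m B) * (C \<otimes>\<^sub>m D) = (A * C) \<otimes>\<^sub>m (B * D)"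
proof (rule eq_matI, goal_cases)
  case (1 i j)
  then have ij: "i < dim_row A * dim_row B" "j < dim_col C * dim_col D" by simp_all
  note d = div_mod_less[OF ij(1)] div_mod_less[OF ij(2)]
  define g where "g k l = (A $$ (i div dim_row B, k) * B $$ (i mod dim_row B, l)) *
    (C $$ (k, j div dim_col D) * D $$ (l, j mod dim_col D))" for k l
  have "((A \<otimes>\<^sub>m B) * (C \<otimes>\<^sub>m D)) $$ (i, j) =
      (\<Sum>k<dim_row C * dim_row D. g (k div dim_row D) (k mod dim_row D))"
    using ij assms
    by (simp add: times_mat_def scalar_prod_def kron_index g_def atLeast0LessThan)
  also have "\<dots> = (\<Sum>k<dim_row C. \<Sum>l<dim_row D. g k l)" by (rule sum_div_mod)
  also have "\<dots> = (\<Sum>k<dim_row C. A $$ (i div dim_row B, k) * C $$ (k, j div dim_col D)) *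
      (\<Sum>l<dim_row D. B $$ (i mod dim_row B, l) * D $$ (l, j mod dim_col D))"
    by (simp add: sum_product g_def mult_ac)
  also have "\<dots> = ((A * C) \<otimes>\<^sub>m (B * D)) $$ (i, j)"
    using ij d assms by (simp add: times_mat_def scalar_prod_def kron_index atLeast0LessThan)
  finally show ?case .
qed simp_all

lemma kron_one: "1\<^sub>m a \<otimes>\<^sub>m 1\<^sub>m b = (1\<^sub>m (a * b) :: 'a :: semiring_1 mat)"
proof (rule eq_matI, goal_cases)
  case (1 i j)
  note d = div_mod_less[of i a b] div_mod_less[of j a b]
  have "i div b = j div b \<and> i mod b = j mod b \<longleftrightarrow> i = j" by (metis div_mult_mod_eq)
  then show ?case using 1 d by (auto simp: kron_index)
qed simp_all

lemma kron_power_one: "kron_power (1\<^sub>m 2) k = 1\<^sub>m (2 ^ k)"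
  by (induction k) (simp_all add: kron_one)

lemma kron_zero_id [simp]: "A \<otimes>\<^sub>m 1\<^sub>m (Suc 0) = A" "1\<^sub>m (Suc 0) \<otimes>\<^sub>m A = A"
  by (rule eq_matI; simp add: kron_index)+

lemma braid_mat_carrier [simp]: "dim_row (braid_mat a) = 4" "dim_col (braid_mat a) = 4"
  by (simp_all add: braid_mat_def mat_of_rows_list_def)

lemma mat_of_rows_list_mult:
  fixes L M :: "'a :: semiring_0 list list"
  assumes "\<forall>r\<in>set L. length r = n" "length M = n"
  shows "mat_of_rows_list n L * mat_of_rows_list k M =
    mat_of_rows_list k
      (map (\<lambda>r. map (\<lambda>j. \<Sum>(x, y)\<leftarrow>zip r M. x * y ! j) [0..<k]) L)"
proof (rule eq_matI, goal_cases)
  case (1 i j)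
  then have ij: "i < length L" "j < k" by (simp_all add: mat_of_rows_list_def)
  then have "length (L ! i) = n" using assms by simp
  then show ?case using ij assms
    by (simp add: mat_of_rows_list_def times_mat_def scalar_prod_def sum_list_sum_nth
        atLeast0LessThan)
qed (simp_all add: mat_of_rows_list_def)

lemma braid_mat_sq: "braid_mat a * braid_mat a = 1\<^sub>m 4"
proof -
  have "1\<^sub>m 4 = (mat_of_rows_list 4
      [[1, 0, 0, 0], [0, 1, 0, 0], [0, 0, 1, 0], [0, 0, 0, 1]] :: complex mat)"
    by (rule eq_matI) (auto simp: mat_of_rows_list_def less_Suc_eq numeral_eq_Suc)
  then show ?thesis
    by (simp add: braid_mat_def mat_of_rows_list_mult upt_rec)
qed

lemma braid_mat_one:
  "braid_mat a \<otimes>\<^sub>m 1\<^sub>m 2 = mat_of_rows_list 8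
    [[1, 0, 0, 0, 0, 0, a, 0],
     [0, 1, 0, 0, 0, 0, 0, a],
     [0, 0, 0, 0, 1, 0, 0, 0],
     [0, 0, 0, 0, 0, 1, 0, 0],
     [0, 0, 1, 0, 0, 0, 0, 0],
     [0, 0, 0, 1, 0, 0, 0, 0],
     [0, 0, 0, 0, 0, 0, -1, 0],
     [0, 0, 0, 0, 0, 0, 0, -1]]" (is "?L = ?R")
proof (rule eq_matI, goal_cases)
  case (1 i j)
  then have "i \<in> set [0..<8]" "j \<in> set [0..<8]" by (auto simp: mat_of_rows_list_def)
  then show ?case
    unfolding braid_mat_def mat_of_rows_list_def by (auto simp: kron_index upt_rec)
qed (simp_all add: mat_of_rows_list_def)

lemma one_braid_mat:
  "1\<^sub>m 2 \<otimes>\<^sub>m braid_mat a = mat_of_rows_list 8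
    [[1, 0, 0, a, 0, 0, 0, 0],
     [0, 0, 1, 0, 0, 0, 0, 0],
     [0, 1, 0, 0, 0, 0, 0, 0],
     [0, 0, 0, -1, 0, 0, 0, 0],
     [0, 0, 0, 0, 1, 0, 0, a],
     [0, 0, 0, 0, 0, 0, 1, 0],
     [0, 0, 0, 0, 0, 1, 0, 0],
     [0, 0, 0, 0, 0, 0, 0, -1]]" (is "?L = ?R")
proof (rule eq_matI, goal_cases)
  case (1 i j)
  then have "i \<in> set [0..<8]" "j \<in> set [0..<8]" by (auto simp: mat_of_rows_list_def)
  then show ?case
    unfolding braid_mat_def mat_of_rows_list_def by (auto simp: kron_index upt_rec)
qed (simp_all add: mat_of_rows_list_def)

lemma braid_mat_yb:
  "(braid_mat a \<otimes>\<^sub>m 1\<^sub>m 2) * (1\<^sub>m 2 \<otimes>\<^sub>m braid_mat b) * (braid_mat c \<otimes>\<^sub>m 1\<^sub>m 2) =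
   (1\<^sub>m 2 \<otimes>\<^sub>m braid_mat c) * (braid_mat b \<otimes>\<^sub>m 1\<^sub>m 2) * (1\<^sub>m 2 \<otimes>\<^sub>m braid_mat a)"
  by (simp add: braid_mat_one one_braid_mat mat_of_rows_list_mult upt_rec)

lemma two_power_split:
  assumes "i \<in> {1..<n}"
  shows "(2 :: nat) ^ (i - 1) * 4 * 2 ^ (n - i - 1) = 2 ^ n"
proof -
  have "(2 :: nat) ^ (i - 1) * 2 ^ 2 * 2 ^ (n - i - 1) = 2 ^ (i - 1 + 2 + (n - i - 1))"
    by (simp only: power_add)
  also have "i - 1 + 2 + (n - i - 1) = n" using assms by auto
  finally show ?thesis by simp
qed

lemma local_op_carrier:
  assumes "i \<in> {1..<n}"
  shows "local_op n (braid_mat a) i \<in> carrier_mat (2 ^ n) (2 ^ n)"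
  unfolding local_op_def kron_power_one
  by (rule carrier_matI)
    (simp_all only: kron_dim braid_mat_carrier index_one_mat two_power_split[OF assms])

lemma local_op_mult:
  "local_op n (braid_mat a) i * local_op n (braid_mat b) i =
    kron_power (1\<^sub>m 2) (i - 1) \<otimes>\<^sub>m (braid_mat a * braid_mat b) \<otimes>\<^sub>m kron_power (1\<^sub>m 2) (n - i - 1)"
  by (simp add: local_op_def kron_power_one kron_mult)

lemma local_op_sq:
  assumes "i \<in> {1..<n}"
  shows "local_op n (braid_mat a) i * local_op n (braid_mat a) i = 1\<^sub>m (2 ^ n)"
  unfolding local_op_mult braid_mat_sq kron_power_one kron_one two_power_split[OF assms] ..

lemma local_op_yb:
  assumes "1 \<le> i" "i + 1 < n"
  shows "local_op n (braid_mat a) i * local_op n (braid_mat b) (i+1) * local_op n (braid_mat c) i =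
    local_op n (braid_mat c) (i+1) * local_op n (braid_mat b) i * local_op n (braid_mat a) (i+1)"
proof -
  define x z where "x = (2 :: nat) ^ (i - 1)" and "z = (2 :: nat) ^ (n - i - 2)"
  have z: "2 ^ (n - i - 1) = 2 * z"
    using assms unfolding z_def by (metis Suc_diff_Suc add.commute diff_diff_left
        one_add_one plus_1_eq_Suc power_Suc)
  have x: "2 ^ (i + 1 - 1) = x * 2"
    using assms unfolding x_def by (cases i) auto
  have 1: "local_op n (braid_mat d) i = 1\<^sub>m x \<otimes>\<^sub>m (braid_mat d \<otimes>\<^sub>m 1\<^sub>m 2) \<otimes>\<^sub>m 1\<^sub>m z" for d
    unfolding local_op_def kron_power_one z x_def[symmetric] kron_one[symmetric]
    by (simp add: kron_assoc)
  have "n - (i + 1) - 1 = n - i - 2" by simp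
  then have 2: "local_op n (braid_mat d) (i+1) = 1\<^sub>m x \<otimes>\<^sub>m (1\<^sub>m 2 \<otimes>\<^sub>m braid_mat d) \<otimes>\<^sub>m 1\<^sub>m z" for d
    unfolding local_op_def kron_power_one x z_def kron_one[symmetric]
    by (simp add: kron_assoc)
  show ?thesis unfolding 1 2 by (simp add: kron_mult braid_mat_yb)
qed

lemma local_op_comm_less:
  assumes "1 \<le> i" "i + 1 < j" "j < n"
  shows "local_op n (braid_mat a) i * local_op n (braid_mat b) j =
    local_op n (braid_mat b) j * local_op n (braid_mat a) i"
proof -
  define x y z where "x = (2 :: nat) ^ (i - 1)" and "y = (2 :: nat) ^ (j - i - 2)"
    and "z = (2 :: nat) ^ (n - j - 1)"
  have "n - i - 1 = (j - i - 2) + (2 + (n - j - 1))" "j - 1 = (i - 1) + (2 + (j - i - 2))"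
    using assms by simp_all
  then have r: "2 ^ (n - i - 1) = y * (4 * z)" and l: "2 ^ (j - 1) = x * (4 * y)"
    unfolding x_def y_def z_def by (simp_all only: power_add) simp_all
  have 1: "local_op n (braid_mat a) i = 1\<^sub>m x \<otimes>\<^sub>m (braid_mat a \<otimes>\<^sub>m (1\<^sub>m y \<otimes>\<^sub>m (1\<^sub>m 4 \<otimes>\<^sub>m 1\<^sub>m z)))"
    unfolding local_op_def kron_power_one r x_def[symmetric] kron_one[symmetric]
    by (simp only: kron_assoc)
  have 2: "local_op n (braid_mat b) j = 1\<^sub>m x \<otimes>\<^sub>m (1\<^sub>m 4 \<otimes>\<^sub>m (1\<^sub>m y \<otimes>\<^sub>m (braid_mat b \<otimes>\<^sub>m 1\<^sub>m z)))"
    unfolding local_op_def kron_power_one l z_def[symmetric] kron_one[symmetric]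
    by (simp only: kron_assoc)
  have c: "braid_mat d \<in> carrier_mat 4 4" for d by (rule carrier_matI) simp_all
  have m: "1\<^sub>m 4 * braid_mat d = braid_mat d" "braid_mat d * 1\<^sub>m 4 = braid_mat d" for d
    using left_mult_one_mat[OF c] right_mult_one_mat[OF c] by blast+
  show ?thesis unfolding 1 2 by (simp add: kron_mult m)
qed

lemma local_op_comm:
  assumes "i \<in> {1..<n}" "j \<in> {1..<n}" "\<bar>int i - int j\<bar> > 1"
  shows "local_op n (braid_mat a) i * local_op n (braid_mat b) j =
    local_op n (braid_mat b) j * local_op n (braid_mat a) i"
proof (cases "i < j")
  case True
  then show ?thesis using assms by (intro local_op_comm_less) auto
next
  case False
  then show ?thesis using assms by (intro local_op_comm_less[symmetric]) auto
qed

lemma group_GL: "group (GL d)"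
proof -
  interpret ring "ring_mat TYPE(complex) d ()" by (rule ring_mat)
  show ?thesis by (rule units_group)
qed

lemma md_rep_exists: "\<exists>\<rho>. is_md_rep n p q \<rho>"
proof -
  interpret group "GL (2 ^ n)" by (rule group_GL)
  define f where "f x = (case x of
      Sgen i \<Rightarrow> local_op n (braid_mat p) i | Rgen i \<Rightarrow> local_op n (braid_mat q) i)" for x
  have U: "local_op n (braid_mat a) i \<in> carrier (GL (2 ^ n))" if "i \<in> {1..<n}" for a i
    using local_op_carrier[OF that, of a] local_op_sq[OF that, of a]
    by (auto simp: units_of_def Units_def ring_mat_simps)
  have f: "f \<in> md_gens n \<rightarrow> carrier (GL (2 ^ n))"
    using U by (auto simp: f_def md_gens_def)
  have one: "A * 1\<^sub>m (2 ^ n) = A" if "A \<in> carrier (GL (2 ^ n))" for A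
    using r_one[OF that] by (simp add: units_of_def ring_mat_simps)
  have ev: "word_eval (GL (2 ^ n)) f [] = 1\<^sub>m (2 ^ n)"
    "word_eval (GL (2 ^ n)) f ((x, True) # w) = f x * word_eval (GL (2 ^ n)) f w" for x w
    by (simp_all add: word_eval_simps) (simp_all add: units_of_def ring_mat_simps)
  have assoc: "A * (B * C) = A * B * C"
    if "A \<in> carrier (GL (2 ^ n))" "B \<in> carrier (GL (2 ^ n))" "C \<in> carrier (GL (2 ^ n))" for A B C
    using m_assoc[OF that] by (simp add: units_of_def ring_mat_simps)
  have Q: "word_eval (GL (2 ^ n)) f l = word_eval (GL (2 ^ n)) f r" if "(l, r) \<in> md_rels n" for l r
    using that
  proof (cases rule: md_rels.cases)
    case (rrr i)
    then show ?thesis using local_op_yb[of i n q q q] by (simp add: ev one U f_def assoc)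
  next
    case (rrs i)
    then show ?thesis using local_op_yb[of i n q q p] by (simp add: ev one U f_def assoc)
  next
    case (rss i)
    then show ?thesis using local_op_yb[of i n q p p] by (simp add: ev one U f_def assoc)
  next
    case (sss i)
    then show ?thesis using local_op_yb[of i n p p p] by (simp add: ev one U f_def assoc)
  next
    case (s_sq i)
    then show ?thesis using local_op_sq[of i n p] by (simp add: ev one U f_def)
  next
    case (r_sq i)
    then show ?thesis using local_op_sq[of i n q] by (simp add: ev one U f_def)
  next
    case (rr_comm i j)
    then show ?thesis using local_op_comm[of i n j q q] by (simp add: ev one U f_def)
  next
    case (ss_comm i j)
    then show ?thesis using local_op_comm[of i n j p p] by (simp add: ev one U f_def)
  next
    case (rs_comm i j)
    then show ?thesis using local_op_comm[of i n j q p] by (simp add: ev one U f_def)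
  qed
  obtain \<rho> where "group_hom (MD n) (GL (2 ^ n)) \<rho>"
    "\<forall>x\<in>md_gens n. \<rho> (word_class (md_gens n) (md_rels n) [(x, True)]) = f x"
    using presented_group_hom_exists[OF group_GL f Q] unfolding MD_def by blast
  then have "is_md_rep n p q \<rho>"
    by (auto simp: is_md_rep_def is_representation_def md_gens_def md_s_def md_r_def f_def)
  then show "\<exists>\<rho>. is_md_rep n p q \<rho>" by blast
qed

end

theory Submission
  imports Defs
begin

text \<open>The matrices \<open>R\<close> and \<open>S\<close> are combinations of one signed flip (the case \<open>q = 0\<close>) and
  \<open>N = E\<^bsub>00,11\<^esub>\<close>; since \<open>S - R = (p - q) N\<close>, a subspace is invariant iff it is invariant under all
  signed flips and all lowering operators \<open>N\<^sub>i\<close>.  Both preserve the parity of the number of ones in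
  a basis vector, which gives the two summands.  Lowering repeatedly and moving ones next to each
  other with the flips, one finds in every nonzero invariant subspace a nonzero vector supported on
  basis vectors with at most one 1.  In the even summand this is a multiple of \<open>e\<^bsub>0\<dots>0\<^esub>\<close>, so any two
  nonzero invariant subspaces meet.  In the odd summand, let \<open>A \<oplus> B\<close> be an invariant decomposition
  and let \<open>e\<close> have its only 1 at the last site.  As \<open>e\<close> is a lowering of the vector with ones
  exactly at the last three sites (this needs \<open>n \<ge> 3\<close>), the \<open>A\<close>-component of \<open>e\<close> vanishes at the
  neighbouring site; by flip symmetry it vanishes at all other sites and is thus a multiple of \<open>e\<close>.  So \<open>e\<close>
  lies in \<open>A\<close> or \<open>B\<close>, along with all vectors with a single 1, and the other summand is \<open>0\<close>.\<close>

section \<open>Signed flips and lowering operators\<close>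

text \<open>Toggling two adjacent bits exchanges them when they differ and trades 00 for 11 when
  they agree, so this one involution locates the off-diagonal entries of the flip and those of the
  lowering operator.\<close>

definition pair_flip :: "nat \<Rightarrow> nat \<Rightarrow> nat" where
  "pair_flip b k = flip_bit b (flip_bit (Suc b) k)"

lemma nat_eq_iff_bit: "k = l \<longleftrightarrow> (\<forall>i. bit k i = bit l i)" for k l :: nat
  using bit_eq_iff[of k l] by simp

lemma bit_pair_flip:
  "bit (pair_flip b k) i \<longleftrightarrow> (if i = b \<or> i = Suc b then \<not> bit k i else bit k i)"
  by (auto simp: pair_flip_def bit_flip_bit_iff)

lemma pair_flip_pair_flip [simp]: "pair_flip b (pair_flip b k) = k"
  by (rule bit_eqI) (simp add: bit_pair_flip)

lemma pair_flip_neq [simp]: "pair_flip b k \<noteq> k" "k \<noteq> pair_flip b k"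
  using bit_pair_flip[of b k b] by auto

lemma less_power_iff_bit: "k < 2 ^ n \<longleftrightarrow> (\<forall>i\<ge>n. \<not> bit k i)" for k :: nat
proof -
  have "k < 2 ^ n \<longleftrightarrow> take_bit n k = k" by (simp add: take_bit_nat_eq_self_iff)
  also have "\<dots> \<longleftrightarrow> (\<forall>i\<ge>n. \<not> bit k i)"
    unfolding nat_eq_iff_bit[of "take_bit n k"] bit_take_bit_iff by (meson not_less)
  finally show ?thesis .
qed

lemma pair_flip_less [simp]: "Suc b < n \<Longrightarrow> pair_flip b k < 2 ^ n \<longleftrightarrow> k < 2 ^ n"
  by (auto simp: less_power_iff_bit bit_pair_flip)

text \<open>In \<open>local_op\<close> the factor to the right of the matrix has size
  \<open>2 ^ b\<close>, so this digit is the index into the 4 by 4 matrix: it is read off bits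
  \<open>b\<close> and \<open>b + 1\<close>.\<close>

lemma div_power_mod_4: "k div 2 ^ b mod 4 = of_bool (bit k b) + 2 * of_bool (bit k (Suc b))" for k :: nat
proof -
  have "k div 2 ^ b mod (2 * 2) = 2 * (k div 2 ^ b div 2 mod 2) + k div 2 ^ b mod 2"
    by (rule mod_mult2_eq)
  moreover have "k div 2 ^ b div 2 = k div 2 ^ Suc b" by (metis div_mult2_eq power_Suc2)
  ultimately show ?thesis by (simp add: bit_iff_odd mod_2_eq_odd)
qed

text \<open>The left side says that the two identity factors of \<open>local_op\<close> contribute 1
  to the entry at \<open>(k, l)\<close>; in terms of bits, the indices may differ only at the pair
  on which the matrix acts.\<close>

lemma mod_div_power_eq_iff:
  "k mod 2 ^ b = l mod 2 ^ b \<and> k div 2 ^ b div 4 = l div 2 ^ b div 4 \<longleftrightarrow>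
    (\<forall>i. i \<noteq> b \<longrightarrow> i \<noteq> Suc b \<longrightarrow> bit k i = bit l i)" (is "?L \<longleftrightarrow> ?R") for k l :: nat
proof -
  have "m div 2 ^ b div 4 = drop_bit (Suc (Suc b)) m" for m :: nat
    by (simp add: drop_bit_eq_div div_mult2_eq[symmetric] mult.commute)
  then have "?L \<longleftrightarrow> take_bit b k = take_bit b l \<and>
      drop_bit (Suc (Suc b)) k = drop_bit (Suc (Suc b)) l"
    by (simp add: take_bit_eq_mod)
  also have "\<dots> \<longleftrightarrow> (\<forall>i<b. bit k i = bit l i) \<and> (\<forall>i. bit k (Suc (Suc b) + i) = bit l (Suc (Suc b) + i))"
    unfolding nat_eq_iff_bit[of "take_bit b k"] nat_eq_iff_bit[of "drop_bit (Suc (Suc b)) k"]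
      bit_take_bit_iff bit_drop_bit_eq comp_def by meson
  also have "\<dots> \<longleftrightarrow> ?R"
  proof
    assume *: "(\<forall>i<b. bit k i = bit l i) \<and> (\<forall>i. bit k (Suc (Suc b) + i) = bit l (Suc (Suc b) + i))"
    show ?R
    proof (intro allI impI)
      fix i assume "i \<noteq> b" "i \<noteq> Suc b"
      then consider "i < b" | "i = Suc (Suc b) + (i - Suc (Suc b))" by linarith
      then show "bit k i = bit l i" using * by cases metis+
    qed
  qed simp
  finally show ?thesis .
qed

lemma braid_mat_index:
  "braid_mat a $$ (of_bool x + 2 * of_bool y, of_bool x' + 2 * of_bool y') =
    (if x = x' \<and> y = y' then if x = y then if x then -1 else 1 else 0
     else if x \<noteq> x' \<and> y \<noteq> y' then if x = y then if x then 0 else a else 1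
     else 0)"
  by (cases x; cases y; cases x'; cases y')
    (simp_all add: braid_mat_def mat_of_rows_list_def numeral_eq_Suc)

text \<open>Each row has at most two nonzero entries, because \<open>braid_mat\<close> relates a
  pair of bits only to itself or to the pair with both bits toggled.\<close>

lemma local_op_index:
  assumes i: "i \<in> {1..<n}" and k: "k < 2 ^ n" and l: "l < 2 ^ n" and b: "b = n - i - 1"
  shows "local_op n (braid_mat a) i $$ (k, l) =
    (if l = k then if bit k b = bit k (Suc b) then if bit k b then -1 else 1 else 0
     else if l = pair_flip b k then if bit k b = bit k (Suc b) then if bit k b then 0 else a else 1
     else 0)"
proof -
  let ?x = "(2::nat) ^ (i - 1)" and ?z = "(2::nat) ^ b"
  have d: "?x * 4 * ?z = 2 ^ n" using two_power_split[OF i] b by simp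
  have kl: "k < ?x * 4 * ?z" "l < ?x * 4 * ?z" using k l d by simp_all
  note lt = div_mod_less[OF kl(1)] div_mod_less[OF kl(2)]
    div_mod_less[OF div_mod_less(1)[OF kl(1)]] div_mod_less[OF div_mod_less(1)[OF kl(2)]]
  have "local_op n (braid_mat a) i = 1\<^sub>m ?x \<otimes>\<^sub>m braid_mat a \<otimes>\<^sub>m 1\<^sub>m ?z"
    by (simp add: local_op_def kron_power_one b)
  then have "local_op n (braid_mat a) i $$ (k, l) =
      of_bool (k div ?z div 4 = l div ?z div 4) *
      braid_mat a $$ (k div ?z mod 4, l div ?z mod 4) * of_bool (k mod ?z = l mod ?z)"
    using kl lt by (simp add: kron_index)
  also have "\<dots> = of_bool (k mod ?z = l mod ?z \<and> k div ?z div 4 = l div ?z div 4) *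
      braid_mat a $$ (k div ?z mod 4, l div ?z mod 4)"
    by (simp only: of_bool_conj mult_ac)
  finally have 1: "local_op n (braid_mat a) i $$ (k, l) =
      of_bool (\<forall>i. i \<noteq> b \<longrightarrow> i \<noteq> Suc b \<longrightarrow> bit k i = bit l i) *
      braid_mat a $$ (k div ?z mod 4, l div ?z mod 4)"
    unfolding mod_div_power_eq_iff .
  have 2: "l = k \<longleftrightarrow> (\<forall>i. i \<noteq> b \<longrightarrow> i \<noteq> Suc b \<longrightarrow> bit k i = bit l i) \<and>
      bit k b = bit l b \<and> bit k (Suc b) = bit l (Suc b)"
    unfolding nat_eq_iff_bit[of l k] by metis
  have 3: "l = pair_flip b k \<longleftrightarrow> (\<forall>i. i \<noteq> b \<longrightarrow> i \<noteq> Suc b \<longrightarrow> bit k i = bit l i) \<and>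
      bit k b \<noteq> bit l b \<and> bit k (Suc b) \<noteq> bit l (Suc b)"
    unfolding nat_eq_iff_bit[of l "pair_flip b k"] bit_pair_flip by (rule iffI; simp)
  define Q where "Q \<longleftrightarrow> (\<forall>i. i \<noteq> b \<longrightarrow> i \<noteq> Suc b \<longrightarrow> bit k i = bit l i)"
  show ?thesis
    unfolding 1 2 3 div_power_mod_4 braid_mat_index Q_def[symmetric] by auto
qed

text \<open>Sites are numbered by bits of the index: site \<open>i\<close> of the tensor product (counted from the left,
  from 1) is bit \<open>n - i\<close>, so the tensor factors \<open>i\<close> and \<open>i + 1\<close> are bits \<open>b + 1\<close> and \<open>b\<close> for
  \<open>b = n - i - 1\<close>.\<close>

definition swap_op :: "nat \<Rightarrow> nat \<Rightarrow> complex vec \<Rightarrow> complex vec" where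
  "swap_op n b v = vec (2 ^ n) (\<lambda>k. if bit k b = bit k (Suc b) then if bit k b then - (v $ k) else v $ k
     else v $ pair_flip b k)"

definition lower_op :: "nat \<Rightarrow> nat \<Rightarrow> complex vec \<Rightarrow> complex vec" where
  "lower_op n b v = vec (2 ^ n) (\<lambda>k. if bit k b \<or> bit k (Suc b) then 0 else v $ pair_flip b k)"

lemma swap_op_closed [simp]: "swap_op n b v \<in> carrier_vec (2 ^ n)"
  and lower_op_closed [simp]: "lower_op n b v \<in> carrier_vec (2 ^ n)"
  and dim_swap_op [simp]: "dim_vec (swap_op n b v) = 2 ^ n"
  and dim_lower_op [simp]: "dim_vec (lower_op n b v) = 2 ^ n"
  by (simp_all add: swap_op_def lower_op_def)

text \<open>The parameter \<open>a\<close> enters only as the coefficient of the lowering operator.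
  Hence the matrices for two different parameters recover both operators.\<close>

lemma local_op_mult_vec:
  assumes i: "i \<in> {1..<n}" and v: "v \<in> carrier_vec (2 ^ n)" and b: "b = n - i - 1"
  shows "local_op n (braid_mat a) i *\<^sub>v v = swap_op n b v + a \<cdot>\<^sub>v lower_op n b v"
proof (rule eq_vecI)
  fix k assume "k < dim_vec (swap_op n b v + a \<cdot>\<^sub>v lower_op n b v)"
  then have k: "k < 2 ^ n" by simp
  have sb: "Suc b < n" using i b by auto
  \<comment> \<open>In row \<open>k\<close>, \<open>c\<close> is the diagonal entry and
    \<open>d\<close> the entry in column \<open>pair_flip b k\<close>.\<close>
  define c d where "c = (if bit k b = bit k (Suc b) then if bit k b then -1 else 1 else (0::complex))"
    and "d = (if bit k b = bit k (Suc b) then if bit k b then 0 else a else 1)"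
  have "local_op n (braid_mat a) i $$ (k, l) * v $ l =
      (if l = k then c * v $ l else 0) + (if l = pair_flip b k then d * v $ l else 0)"
    if "l < 2 ^ n" for l
    unfolding local_op_index[OF i k that b] c_def[symmetric] d_def[symmetric] by auto
  then have "(local_op n (braid_mat a) i *\<^sub>v v) $ k =
      (\<Sum>l<2 ^ n. (if l = k then c * v $ l else 0) + (if l = pair_flip b k then d * v $ l else 0))"
    using k v local_op_carrier[OF i, of a]
    by (auto simp: scalar_prod_def atLeast0LessThan intro!: sum.cong)
  also have "\<dots> = c * v $ k + d * v $ pair_flip b k"
    using k sb by (simp add: sum.distrib)
  also have "\<dots> = (swap_op n b v + a \<cdot>\<^sub>v lower_op n b v) $ k"
    using k by (simp add: swap_op_def lower_op_def c_def d_def)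
  finally show "(local_op n (braid_mat a) i *\<^sub>v v) $ k = (swap_op n b v + a \<cdot>\<^sub>v lower_op n b v) $ k" .
qed (use carrier_matD[OF local_op_carrier[OF i, of a]] in simp)


lemma swap_op_index:
  "k < 2 ^ n \<Longrightarrow> swap_op n b v $ k =
    (if bit k b = bit k (Suc b) then if bit k b then - (v $ k) else v $ k else v $ pair_flip b k)"
  by (simp add: swap_op_def)

lemma lower_op_index:
  "k < 2 ^ n \<Longrightarrow> lower_op n b v $ k = (if bit k b \<or> bit k (Suc b) then 0 else v $ pair_flip b k)"
  by (simp add: lower_op_def)

lemma swap_op_add:
  "Suc b < n \<Longrightarrow> u \<in> carrier_vec (2 ^ n) \<Longrightarrow> v \<in> carrier_vec (2 ^ n) \<Longrightarrow>
    swap_op n b (u + v) = swap_op n b u + swap_op n b v"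
  by (rule eq_vecI) (simp_all add: swap_op_index)

lemma lower_op_add:
  "Suc b < n \<Longrightarrow> u \<in> carrier_vec (2 ^ n) \<Longrightarrow> v \<in> carrier_vec (2 ^ n) \<Longrightarrow>
    lower_op n b (u + v) = lower_op n b u + lower_op n b v"
  by (rule eq_vecI) (simp_all add: lower_op_index)

lemma lower_op_unit_vec:
  assumes "Suc b < n" "m < 2 ^ n" "bit m b" "bit m (Suc b)"
  shows "lower_op n b (unit_vec (2 ^ n) m) = unit_vec (2 ^ n) (pair_flip b m)"
proof (rule eq_vecI)
  fix k assume "k < dim_vec (unit_vec (2 ^ n) (pair_flip b m) :: complex vec)"
  then have k: "k < 2 ^ n" by simp
  have "pair_flip b k = m \<longleftrightarrow> k = pair_flip b m" by (metis pair_flip_pair_flip)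
  then show "lower_op n b (unit_vec (2 ^ n) m) $ k = unit_vec (2 ^ n) (pair_flip b m) $ k"
    using k assms by (auto simp: lower_op_index unit_vec_def bit_pair_flip)
qed simp

lemma swap_op_unit_vec_zero:
  assumes "Suc b < n" "m < 2 ^ n" "\<not> bit m b" "\<not> bit m (Suc b)"
  shows "swap_op n b (unit_vec (2 ^ n) m) = unit_vec (2 ^ n) m"
proof (rule eq_vecI)
  fix k assume "k < dim_vec (unit_vec (2 ^ n) m :: complex vec)"
  then have k: "k < 2 ^ n" by simp
  have "pair_flip b k = m \<longleftrightarrow> k = pair_flip b m" by (metis pair_flip_pair_flip)
  then show "swap_op n b (unit_vec (2 ^ n) m) $ k = unit_vec (2 ^ n) m $ k"
    using k assms by (auto simp: swap_op_index unit_vec_def bit_pair_flip)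
qed simp

lemma swap_op_unit_vec_one:
  assumes "Suc b < n" "m < 2 ^ n" "bit m b \<noteq> bit m (Suc b)"
  shows "swap_op n b (unit_vec (2 ^ n) m) = unit_vec (2 ^ n) (pair_flip b m)"
proof (rule eq_vecI)
  fix k assume "k < dim_vec (unit_vec (2 ^ n) (pair_flip b m) :: complex vec)"
  then have k: "k < 2 ^ n" by simp
  have "pair_flip b k = m \<longleftrightarrow> k = pair_flip b m" by (metis pair_flip_pair_flip)
  then show "swap_op n b (unit_vec (2 ^ n) m) $ k = unit_vec (2 ^ n) (pair_flip b m) $ k"
    using k assms by (auto simp: swap_op_index unit_vec_def bit_pair_flip)
qed simp

section \<open>The number of ones of a basis index\<close>

definition weight :: "nat \<Rightarrow> nat" where
  "weight k = card {i. bit k i}"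

lemma finite_bits: "finite {i. bit k i}" for k :: nat
proof (rule finite_subset)
  show "{i. bit k i} \<subseteq> {..<k}"
    \<comment> \<open>Since \<open>k < 2 ^ k\<close>, all bits from position \<open>k\<close> on
      vanish.\<close>
    using less_power_iff_bit[of k k] less_exp[of k] by (auto simp: not_le[symmetric])
qed simp

lemma weight_pair_flip_zero:
  assumes "\<not> bit k b" "\<not> bit k (Suc b)"
  shows "weight (pair_flip b k) = weight k + 2"
proof -
  have "{i. bit (pair_flip b k) i} = insert b (insert (Suc b) {i. bit k i})"
    using assms by (auto simp: bit_pair_flip)
  then show ?thesis using assms finite_bits[of k] by (simp add: weight_def)
qed

lemma weight_pair_flip_one:
  assumes "bit k b \<noteq> bit k (Suc b)"
  shows "weight (pair_flip b k) = weight k"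
proof -
  \<comment> \<open>With \<open>x\<close> the set bit of the pair and \<open>y\<close> the clear
    one, the flip replaces \<open>x\<close> by \<open>y\<close> in the set of ones, whichever of
    them is lower.\<close>
  obtain x y where xy: "{x, y} = {b, Suc b}" "bit k x" "\<not> bit k y"
    using assms by (cases "bit k b") (blast, metis insert_commute)
  then have "{i. bit (pair_flip b k) i} = insert y ({i. bit k i} - {x})"
    by (auto simp: bit_pair_flip doubleton_eq_iff)
  moreover have "card (insert y ({i. bit k i} - {x})) = card {i. bit k i}"
    using xy finite_bits[of k] card_Suc_Diff1[of "{i. bit k i}" x] by simp
  ultimately show ?thesis by (simp add: weight_def)
qed

lemma weight_le_one_iff: "weight k \<le> 1 \<longleftrightarrow> (\<forall>i j. bit k i \<longrightarrow> bit k j \<longrightarrow> i = j)"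
  using card_le_Suc0_iff_eq[OF finite_bits[of k]] by (auto simp: weight_def)

lemma weight_eq_0_iff: "weight k = 0 \<longleftrightarrow> k = 0"
  unfolding nat_eq_iff_bit[of k 0] using finite_bits[of k] by (simp add: weight_def)

lemma weight_one_obtains:
  assumes "weight k = 1" "k < 2 ^ n"
  obtains j where "j < n" "k = 2 ^ j"
proof -
  obtain j where j: "{i. bit k i} = {j}"
    using assms(1) unfolding weight_def by (rule card_1_singletonE)
  then have *: "bit k i \<longleftrightarrow> i = j" for i by blast
  then have "k = 2 ^ j" unfolding nat_eq_iff_bit[of k] by (auto simp: bit_exp_iff)
  moreover have "j < n" using * assms(2) by (metis less_power_iff_bit not_le)
  ultimately show ?thesis by (rule that[rotated])
qed

lemma weight_power_2 [simp]: "weight (2 ^ j) = 1"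
  by (simp add: weight_def bit_exp_iff)

section \<open>Subspaces of coordinate space and unit vectors\<close>

lemma subspace_vec_iff:
  "subspace class_ring M (module_vec TYPE('a :: field) N) \<longleftrightarrow>
    M \<subseteq> carrier_vec N \<and> 0\<^sub>v N \<in> M \<and> (\<forall>u\<in>M. \<forall>v\<in>M. u + v \<in> M) \<and> (\<forall>c. \<forall>v\<in>M. c \<cdot>\<^sub>v v \<in> M)"
  using vec_vs[where ?'a = 'a, of N] vec_module[where ?'a = 'a, of N]
  by (auto simp: subspace_def submodule_def module_vec_simps)

lemma subspace_mem_of_unit_vecs:
  fixes v :: "'a :: field vec"
  assumes M: "subspace class_ring M (module_vec TYPE('a) N)"
    and S: "finite S" "\<And>k. k \<in> S \<Longrightarrow> unit_vec N k \<in> M"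
    and v: "v \<in> carrier_vec N" "\<And>k. k < N \<Longrightarrow> v $ k \<noteq> 0 \<Longrightarrow> k \<in> S"
  shows "v \<in> M"
  using S v
proof (induction S arbitrary: v rule: finite_induct)
  case empty
  then have "v = 0\<^sub>v N" by (intro eq_vecI) auto
  then show ?case using M by (simp add: subspace_vec_iff)
next
  case (insert k S)
  \<comment> \<open>Clearing coordinate \<open>k\<close> leaves a vector supported on the smaller
    set.\<close>
  define w where "w = vec N (\<lambda>i. if i = k then 0 else v $ i)"
  have "w \<in> M"
  proof (rule insert.IH)
    show "unit_vec N i \<in> M" if "i \<in> S" for i using insert.prems(1) that by blast
    show "i \<in> S" if "i < N" "w $ i \<noteq> 0" for i
      using insert.prems(3)[of i] that by (auto simp: w_def split: if_splits)
  qed (simp add: w_def)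
  moreover have "unit_vec N k \<in> M" using insert by simp
  moreover have "v = w + v $ k \<cdot>\<^sub>v unit_vec N k"
    using insert.prems(2) by (intro eq_vecI) (auto simp: w_def unit_vec_def)
  ultimately show ?case using M by (metis subspace_vec_iff)
qed

section \<open>Invariant subspaces\<close>

text \<open>Invariance expressed without the group and without \<open>p\<close> and
  \<open>q\<close>; for \<open>p \<noteq> q\<close> it is shown below to coincide with being a
  subrepresentation.\<close>

definition stable_subspace :: "nat \<Rightarrow> complex vec set \<Rightarrow> bool" where
  "stable_subspace n M \<longleftrightarrow> subspace class_ring M (module_vec TYPE(complex) (2 ^ n)) \<and>
    (\<forall>b v. Suc b < n \<longrightarrow> v \<in> M \<longrightarrow> swap_op n b v \<in> M \<and> lower_op n b v \<in> M)"

lemma stable_subspaceD: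
  assumes "stable_subspace n M"
  shows "subspace class_ring M (module_vec TYPE(complex) (2 ^ n))"
    and "M \<subseteq> carrier_vec (2 ^ n)" "0\<^sub>v (2 ^ n) \<in> M"
    and "u \<in> M \<Longrightarrow> v \<in> M \<Longrightarrow> u + v \<in> M" "v \<in> M \<Longrightarrow> c \<cdot>\<^sub>v v \<in> M"
    and "Suc b < n \<Longrightarrow> v \<in> M \<Longrightarrow> swap_op n b v \<in> M" "Suc b < n \<Longrightarrow> v \<in> M \<Longrightarrow> lower_op n b v \<in> M"
  using assms unfolding stable_subspace_def subspace_vec_iff by blast+

text \<open>If a lowering kills a vector, no index in its support has ones at both sites involved.
  Closure of \<open>Z\<close> under flips extends this from adjacent to distant ones.
  \<open>Z\<close> is an arbitrary set, so that it can later be a set of components of a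
  decomposition as well as a part of an invariant subspace.\<close>

lemma weight_le_one_of_killed:
  assumes Z: "\<And>z b. z \<in> Z \<Longrightarrow> Suc b < n \<Longrightarrow> swap_op n b z \<in> Z"
    "\<And>z b. z \<in> Z \<Longrightarrow> Suc b < n \<Longrightarrow> lower_op n b z = 0\<^sub>v (2 ^ n)"
    and z: "z \<in> Z" "k < 2 ^ n" "z $ k \<noteq> 0"
  shows "weight k \<le> 1"
proof -
  \<comment> \<open>Induction on the gap between two ones: a flip moves the upper one down by a site.\<close>
  have no_pair: False
    if "z \<in> Z" "k < 2 ^ n" "z $ k \<noteq> 0" "bit k i" "bit k (Suc (i + d))" for z k i d
    using that
  proof (induction d arbitrary: z k)
    case 0
    have b: "Suc i < n" using 0 by (metis add_0_right less_power_iff_bit not_le)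
    have "lower_op n i z $ pair_flip i k = z $ k"
      using 0 b by (simp add: lower_op_index bit_pair_flip)
    then show False using Z(2)[OF 0(1) b] 0 b by simp
  next
    case (Suc d)
    define b where "b = Suc (i + d)"
    have b: "Suc b < n" "bit k (Suc b)"
      using Suc.prems unfolding b_def by (metis add_Suc_right less_power_iff_bit not_le)+
    show False
    proof (cases "bit k b")
      case True
      then show False using Suc.IH[OF Suc.prems(1-4)] by (simp add: b_def)
    next
      case False
      let ?k = "pair_flip b k"
      have "swap_op n b z $ ?k = z $ k"
        using Suc.prems b False by (simp add: swap_op_index bit_pair_flip)
      moreover have "bit ?k i" using Suc.prems by (simp add: bit_pair_flip b_def)
      moreover have "bit ?k (Suc (i + d))" using False by (simp add: bit_pair_flip b_def)
      ultimately show False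
        using Suc.IH[OF Z(1)[OF Suc.prems(1) b(1)], of ?k] Suc.prems b by simp
    qed
  qed
  show ?thesis unfolding weight_le_one_iff
  proof (intro allI impI)
    fix i j assume ij: "bit k i" "bit k j"
    show "i = j"
    proof (rule linorder_cases[of i j])
      assume "i < j"
      then show ?thesis using no_pair[OF z ij(1), of "j - Suc i"] ij by simp
    next
      assume "j < i"
      then show ?thesis using no_pair[OF z ij(2), of "i - Suc j"] ij by simp
    qed
  qed
qed

text \<open>Take the least bound \<open>d\<close> on the weights in the support of some nonzero
  vector of \<open>M\<close>. Flips preserve the bound and lowering improves it by 2, so by
  minimality every lowering kills the vectors that satisfy the bound, and
  \<open>weight_le_one_of_killed\<close> applies.\<close>

lemma stable_subspace_low_weight:
  assumes M: "stable_subspace n M" and nz: "M \<noteq> {0\<^sub>v (2 ^ n)}"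
  obtains z where "z \<in> M" "z \<noteq> 0\<^sub>v (2 ^ n)" "\<And>k. k < 2 ^ n \<Longrightarrow> z $ k \<noteq> 0 \<Longrightarrow> weight k \<le> 1"
proof -
  define low where "low d z \<longleftrightarrow> (\<forall>k<2 ^ n. z $ k \<noteq> 0 \<longrightarrow> weight k \<le> d)" for d and z :: "complex vec"
  define P where "P d \<longleftrightarrow> (\<exists>z\<in>M. z \<noteq> 0\<^sub>v (2 ^ n) \<and> low d z)" for d
  note D = stable_subspaceD[OF M]
  obtain w where w: "w \<in> M" "w \<noteq> 0\<^sub>v (2 ^ n)" using nz D(3) by blast
  have "weight k \<le> Max (weight ` {..<2 ^ n})" if "k < 2 ^ n" for k using that by simp
  then have "P (Max (weight ` {..<2 ^ n}))" using w unfolding P_def low_def by blast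
  then obtain d where d: "P d" "\<And>d'. d' < d \<Longrightarrow> \<not> P d'" using exists_least_iff[of P] by blast
  define Z where "Z = {z \<in> M. low d z}"
  have Z1: "swap_op n b z \<in> Z" if "z \<in> Z" "Suc b < n" for z b
  proof -
    have "weight k \<le> d" if k: "k < 2 ^ n" "swap_op n b z $ k \<noteq> 0" for k
    proof (cases "bit k b = bit k (Suc b)")
      case True
      then have "z $ k \<noteq> 0" using k by (auto simp: swap_op_index)
      then show ?thesis using \<open>z \<in> Z\<close> k(1) unfolding Z_def low_def by blast
    next
      case False
      then have "z $ pair_flip b k \<noteq> 0" using k by (simp add: swap_op_index)
      moreover have "pair_flip b k < 2 ^ n" using k(1) \<open>Suc b < n\<close> by simp
      ultimately have "weight (pair_flip b k) \<le> d" using \<open>z \<in> Z\<close> unfolding Z_def low_def by blast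
      then show ?thesis using weight_pair_flip_one[OF False] by simp
    qed
    then show ?thesis using that D(6) unfolding Z_def low_def by blast
  qed
  have Z2: "lower_op n b z = 0\<^sub>v (2 ^ n)" if z: "z \<in> Z" "Suc b < n" for z b
  proof (rule ccontr)
    assume nz: "lower_op n b z \<noteq> 0\<^sub>v (2 ^ n)"
    have wt: "weight k + 2 \<le> d"
      if k: "k < 2 ^ n" "lower_op n b z $ k \<noteq> 0" for k
    proof -
      have b: "\<not> bit k b" "\<not> bit k (Suc b)" and "z $ pair_flip b k \<noteq> 0"
        using k by (simp_all add: lower_op_index split: if_splits)
      moreover have "pair_flip b k < 2 ^ n" using k(1) z(2) by simp
      ultimately have "weight (pair_flip b k) \<le> d" using z(1) unfolding Z_def low_def by blast
      then show ?thesis using weight_pair_flip_zero[OF b] by simp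
    qed
    \<comment> \<open>A nonzero coefficient forces \<open>d\<close> to be at least 2, so the
      truncated difference \<open>d - 2\<close> is really smaller than \<open>d\<close>.\<close>
    obtain k where "k < 2 ^ n" "lower_op n b z $ k \<noteq> 0"
      using nz eq_vecI[of "0\<^sub>v (2 ^ n)" "lower_op n b z"] by auto
    then have "weight k + 2 \<le> d" by (rule wt)
    then have "d - 2 < d" by simp
    moreover have "low (d - 2) (lower_op n b z)"
      unfolding low_def using wt by (auto intro: add_le_imp_le_diff)
    then have "P (d - 2)" unfolding P_def using nz z D(7) Z_def by blast
    ultimately show False using d(2) by blast
  qed
  obtain z where z: "z \<in> Z" "z \<noteq> 0\<^sub>v (2 ^ n)" using d(1) unfolding P_def Z_def by blast
  show ?thesis
    using that[of z] z weight_le_one_of_killed[of Z n z, OF Z1 Z2] by (auto simp: Z_def)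
qed

section \<open>The parity decomposition\<close>

definition parity_space :: "nat \<Rightarrow> bool \<Rightarrow> complex vec set" where
  "parity_space n c = {v \<in> carrier_vec (2 ^ n). \<forall>k<2 ^ n. v $ k \<noteq> 0 \<longrightarrow> even (weight k) = c}"

lemma parity_spaceD:
  assumes "v \<in> parity_space n c"
  shows "v \<in> carrier_vec (2 ^ n)" "k < 2 ^ n \<Longrightarrow> v $ k \<noteq> 0 \<Longrightarrow> even (weight k) = c"
  using assms by (simp_all add: parity_space_def)

text \<open>Where a flip or a lowering reads a coefficient at another index, the weights of the two
  indices are equal or differ by 2.\<close>

lemma stable_parity_space: "stable_subspace n (parity_space n c)"
  unfolding stable_subspace_def subspace_vec_iff
proof (intro conjI ballI allI impI)
  show "parity_space n c \<subseteq> carrier_vec (2 ^ n)" "0\<^sub>v (2 ^ n) \<in> parity_space n c"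
    by (auto simp: parity_space_def)
next
  fix u v assume u: "u \<in> parity_space n c" and v: "v \<in> parity_space n c"
  have "even (weight k) = c" if "k < 2 ^ n" "(u + v) $ k \<noteq> 0" for k
  proof -
    have "u $ k \<noteq> 0 \<or> v $ k \<noteq> 0" using that parity_spaceD(1)[OF v] by auto
    then show ?thesis using parity_spaceD(2) u v that(1) by blast
  qed
  then show "u + v \<in> parity_space n c"
    using parity_spaceD(1) u v by (simp add: parity_space_def)
next
  fix a v assume v: "v \<in> parity_space n c"
  then show "a \<cdot>\<^sub>v v \<in> parity_space n c" by (auto simp: parity_space_def)
next
  fix b v assume b: "Suc b < n" and v: "v \<in> parity_space n c"
  have "even (weight k) = c" if "k < 2 ^ n" "swap_op n b v $ k \<noteq> 0" for k
  proof (cases "bit k b = bit k (Suc b)")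
    case True
    then show ?thesis
      using that parity_spaceD(2)[OF v that(1)] by (auto simp: swap_op_index)
  next
    case False
    then show ?thesis
      using that b parity_spaceD(2)[OF v, of "pair_flip b k"]
      by (simp add: swap_op_index weight_pair_flip_one)
  qed
  then show "swap_op n b v \<in> parity_space n c" by (simp add: parity_space_def)
  have "even (weight k) = c" if "k < 2 ^ n" "lower_op n b v $ k \<noteq> 0" for k
  proof -
    have z: "\<not> bit k b" "\<not> bit k (Suc b)" using that by (auto simp: lower_op_index)
    then show ?thesis
      using that b parity_spaceD(2)[OF v, of "pair_flip b k"] weight_pair_flip_zero[OF z]
      by (simp add: lower_op_index)
  qed
  then show "lower_op n b v \<in> parity_space n c" by (simp add: parity_space_def)
qed

lemma parity_space_direct_sum:
  "is_direct_sum (2 ^ n) (carrier_vec (2 ^ n)) (parity_space n True) (parity_space n False)"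
proof -
  have "v \<in> {a + b | a b. a \<in> parity_space n True \<and> b \<in> parity_space n False}"
    if v: "v \<in> carrier_vec (2 ^ n)" for v
  proof -
    define p where "p c = vec (2 ^ n) (\<lambda>k. if even (weight k) = c then v $ k else 0)" for c
    have "v = p True + p False" using v by (intro eq_vecI) (simp_all add: p_def)
    moreover have "p c \<in> parity_space n c" for c by (simp add: p_def parity_space_def)
    ultimately show ?thesis by blast
  qed
  moreover have "v = 0\<^sub>v (2 ^ n)" if "v \<in> parity_space n True" "v \<in> parity_space n False" for v
    using parity_spaceD[OF that(1)] parity_spaceD(2)[OF that(2)] by (intro eq_vecI) auto
  moreover have "0\<^sub>v (2 ^ n) \<in> parity_space n c" for c
    using stable_parity_space by (rule stable_subspaceD)
  moreover have "a + b \<in> carrier_vec (2 ^ n)"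
    if "a \<in> parity_space n True" "b \<in> parity_space n False" for a b
    using that parity_spaceD(1) by (intro add_carrier_vec)
  ultimately show ?thesis
    unfolding is_direct_sum_def by (intro conjI subset_antisym subsetI) (auto simp del: carrier_vec_dim_vec)
qed

section \<open>Dimension of the two summands\<close>

text \<open>Toggling bit 0 is a bijection between indices of even and of odd weight;
  \<open>n > 0\<close> keeps it inside the range.\<close>

lemma card_parity:
  assumes "n > 0"
  shows "card {k. k < 2 ^ n \<and> even (weight k) = c} = 2 ^ (n - 1)"
proof -
  let ?S = "\<lambda>c. {k. k < 2 ^ n \<and> even (weight k) = c}"
  have bit: "bit (flip_bit 0 k) i = (if i = 0 then \<not> bit k i else bit k i)" for k i :: nat
    by (auto simp: bit_flip_bit_iff)
  have flip: "flip_bit 0 (flip_bit 0 k) = k" for k :: nat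
    by (rule bit_eqI) (simp add: bit)
  have less: "flip_bit 0 k < 2 ^ n \<longleftrightarrow> k < 2 ^ n" for k :: nat
    using assms by (auto simp: less_power_iff_bit bit)
  have wt0: "weight (flip_bit 0 k) = Suc (weight k)" if "\<not> bit k 0" for k
  proof -
    have "{i. bit (flip_bit 0 k) i} = insert 0 {i. bit k i}" 
      using that by (auto simp: bit split: if_splits)
    then show ?thesis using that finite_bits[of k] by (simp add: weight_def)
  qed
  have wt: "even (weight (flip_bit 0 k)) \<longleftrightarrow> odd (weight k)" for k
  proof (cases "bit k 0")
    case True
    \<comment> \<open>When bit 0 is set, the weight formula is applied to the toggled index, and
      toggling again returns to \<open>k\<close>.\<close>
    then have "\<not> bit (flip_bit 0 k) 0" by (simp only: bit) simp
    from wt0[OF this] show ?thesis unfolding flip by simp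
  qed (simp add: wt0)
  have "bij_betw (flip_bit 0) (?S True) (?S False)"
    by (rule bij_betw_byWitness[where f' = "flip_bit 0"]) (auto simp: flip less wt)
  then have eq: "card (?S True) = card (?S False)" by (rule bij_betw_same_card)
  have "card (?S True \<union> ?S False) = card (?S True) + card (?S False)"
    by (rule card_Un_disjoint) auto
  moreover have "?S True \<union> ?S False = {..<2 ^ n}" by auto
  moreover have "(2::nat) ^ n = 2 * 2 ^ (n - 1)" using assms by (simp add: power_eq_if)
  ultimately show ?thesis using eq by (cases c) simp_all
qed

text \<open>The support condition makes \<open>M\<close> the span of the unit vectors indexed by
  \<open>S\<close>, and these are independent as part of the standard basis.\<close>

lemma dim_coordinate_subspace:
  fixes M :: "complex vec set"
  assumes M: "subspace class_ring M (module_vec TYPE(complex) N)"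
    and S: "S \<subseteq> {..<N}" and mem: "\<And>k. k \<in> S \<Longrightarrow> unit_vec N k \<in> M"
    and supp: "\<And>v k. v \<in> M \<Longrightarrow> k < N \<Longrightarrow> v $ k \<noteq> 0 \<Longrightarrow> k \<in> S"
  shows "subspace_dim N M = card S"
proof -
  interpret vec_space "TYPE(complex)" N .
  let ?B = "unit_vec N ` S :: complex vec set"
  have BM: "?B \<subseteq> M" using mem by blast
  have Mc: "M \<subseteq> carrier_vec N" using M by (simp add: subspace_vec_iff)
  have fin: "finite S" using S finite_subset by blast
  have "inj_on (unit_vec N :: nat \<Rightarrow> complex vec) S"
    using S by (auto intro!: inj_onI simp: unit_vec_eq)
  then have card: "card ?B = card S" by (rule card_image)
  have sub: "submodule class_ring M V" using M by (simp add: subspace_def)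
  have span: "span ?B = M"
  proof
    have sp: "subspace class_ring (span ?B) V"
      using BM Mc by (intro span_is_subspace) auto
    have "unit_vec N k \<in> span ?B" if "k \<in> S" for k
      using that BM Mc by (intro span_mem) auto
    then show "M \<subseteq> span ?B"
      using subspace_mem_of_unit_vecs[OF sp fin] supp Mc by blast
    show "span ?B \<subseteq> M" using span_is_subset[OF BM sub] .
  qed
  have "?B \<subseteq> set (unit_vecs N)" using S by (auto simp: unit_vecs_def)
  then have li: "\<not> lin_dep ?B"
    using subset_li_is_li[of "set (unit_vecs N)" ?B] unit_vecs_basis unfolding basis_def by blast
  have vs: "vectorspace class_ring (V\<lparr>carrier := M\<rparr>)" using subspace_is_vs[OF M] by simp
  \<comment> \<open>Span and independence have to be transferred from the whole space to the module
    with carrier \<open>M\<close>, in which \<open>subspace_dim\<close> is computed.\<close>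
  have "vectorspace.basis class_ring (V\<lparr>carrier := M\<rparr>) ?B"
    unfolding vectorspace.basis_def[OF vs]
    using span_li_not_depend[OF BM sub] span li BM by simp
  from vectorspace.dim_basis[OF vs _ this] show ?thesis
    using fin card by (simp add: subspace_dim_def)
qed

lemma dim_parity_space:
  assumes "n > 0"
  shows "subspace_dim (2 ^ n) (parity_space n c) = 2 ^ (n - 1)"
proof -
  have "subspace_dim (2 ^ n) (parity_space n c) = card {k. k < 2 ^ n \<and> even (weight k) = c}"
  proof (rule dim_coordinate_subspace)
    show "subspace class_ring (parity_space n c) (module_vec TYPE(complex) (2 ^ n))"
      using stable_parity_space by (rule stable_subspaceD)
  qed (auto simp: parity_space_def unit_vec_def split: if_splits)
  then show ?thesis using card_parity[OF assms] by simp
qed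

section \<open>Indecomposability of the two summands\<close>

lemma direct_summand_subset:
  assumes A: "stable_subspace n A" and B: "stable_subspace n B" and sum: "is_direct_sum (2 ^ n) W A B"
  shows "A \<subseteq> W" "B \<subseteq> W"
proof -
  have "a + 0\<^sub>v (2 ^ n) \<in> W" if "a \<in> A" for a
    using that stable_subspaceD(3)[OF B] sum unfolding is_direct_sum_def by blast
  then show "A \<subseteq> W" using stable_subspaceD(2)[OF A] by fastforce
  have "0\<^sub>v (2 ^ n) + b \<in> W" if "b \<in> B" for b
    using that stable_subspaceD(3)[OF A] sum unfolding is_direct_sum_def by blast
  then show "B \<subseteq> W" using stable_subspaceD(2)[OF B] by fastforce
qed

text \<open>An even weight of at most 1 is 0, so the low-weight vector of a nonzero invariant
  subspace is a multiple of the basis vector with index 0. Two such subspaces therefore cannot meet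
  in zero only.\<close>

lemma even_indecomposable:
  assumes A: "stable_subspace n A" and B: "stable_subspace n B"
    and sum: "is_direct_sum (2 ^ n) (parity_space n True) A B"
  shows "A = {0\<^sub>v (2 ^ n)} \<or> B = {0\<^sub>v (2 ^ n)}"
proof (rule ccontr)
  have vacuum: "unit_vec (2 ^ n) 0 \<in> M"
    if M: "stable_subspace n M" "M \<noteq> {0\<^sub>v (2 ^ n)}" "M \<subseteq> parity_space n True" for M
  proof -
    obtain z where z: "z \<in> M" "z \<noteq> 0\<^sub>v (2 ^ n)" "\<And>k. k < 2 ^ n \<Longrightarrow> z $ k \<noteq> 0 \<Longrightarrow> weight k \<le> 1"
      using stable_subspace_low_weight[OF M(1,2)] by blast
    have zp: "z \<in> parity_space n True" using z(1) M(3) by blast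
    have supp: "k = 0" if k: "k < 2 ^ n" "z $ k \<noteq> 0" for k
    proof -
      have "weight k \<le> 1" "even (weight k)" using z(3) parity_spaceD(2)[OF zp] k by simp_all
      then have "weight k = 0" by (cases "weight k = 1") auto
      then show ?thesis by (simp add: weight_eq_0_iff)
    qed
    have "z = z $ 0 \<cdot>\<^sub>v unit_vec (2 ^ n) 0"
      using supp parity_spaceD(1)[OF zp] by (intro eq_vecI) (auto simp: unit_vec_def)
    moreover from this have "z $ 0 \<noteq> 0" using z(2) by auto
    ultimately have "unit_vec (2 ^ n) 0 = inverse (z $ 0) \<cdot>\<^sub>v z"
      by (metis left_inverse one_smult_vec smult_smult_assoc)
    then show ?thesis using stable_subspaceD(5)[OF M(1) z(1)] by metis
  qed
  assume "\<not> ?thesis"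
  then have "unit_vec (2 ^ n) 0 \<in> A \<inter> B" using vacuum A B direct_summand_subset[OF A B sum] by blast
  then have "unit_vec (2 ^ n) 0 = (0\<^sub>v (2 ^ n) :: complex vec)"
    using sum unfolding is_direct_sum_def by blast
  then have "(unit_vec (2 ^ n) 0 :: complex vec) $ 0 = 0\<^sub>v (2 ^ n) $ 0" by metis
  then show False by simp
qed

lemma odd_low_weight:
  assumes M: "stable_subspace n M" "M \<noteq> {0\<^sub>v (2 ^ n)}" "M \<subseteq> parity_space n False"
  obtains z where "z \<in> M" "z \<noteq> 0\<^sub>v (2 ^ n)"
    "\<And>k. k < 2 ^ n \<Longrightarrow> z $ k \<noteq> 0 \<Longrightarrow> k \<in> (\<lambda>j. 2 ^ j) ` {..<n}"
proof -
  obtain z where z: "z \<in> M" "z \<noteq> 0\<^sub>v (2 ^ n)" "\<And>k. k < 2 ^ n \<Longrightarrow> z $ k \<noteq> 0 \<Longrightarrow> weight k \<le> 1"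
    using stable_subspace_low_weight[OF M(1,2)] by blast
  have zp: "z \<in> parity_space n False" using z(1) M(3) by blast
  have "k \<in> (\<lambda>j. 2 ^ j) ` {..<n}" if k: "k < 2 ^ n" "z $ k \<noteq> 0" for k
  proof -
    have "weight k \<le> 1" "odd (weight k)" using z(3) parity_spaceD(2)[OF zp] k by simp_all
    then have "weight k = 1" by (cases "weight k = 0") auto
    then show ?thesis using k(1) by (metis weight_one_obtains imageI lessThan_iff)
  qed
  then show ?thesis using that z(1,2) by blast
qed

text \<open>Successive flips carry the single one upwards from bit 0.\<close>

lemma unit_power_mem:
  assumes M: "stable_subspace n M" "unit_vec (2 ^ n) 1 \<in> M" and j: "j < n"
  shows "unit_vec (2 ^ n) (2 ^ j) \<in> M"
  using j
proof (induction j)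
  case 0
  then show ?case using M by simp
next
  case (Suc j)
  have "pair_flip j (2 ^ j) = 2 ^ Suc j"
    by (rule bit_eqI) (auto simp only: bit_pair_flip bit_exp_iff split: if_splits)
  moreover have "(2::nat) ^ j < 2 ^ n" using Suc.prems by simp
  ultimately have "swap_op n j (unit_vec (2 ^ n) (2 ^ j)) = unit_vec (2 ^ n) (2 ^ Suc j)"
    using swap_op_unit_vec_one[of j n "2 ^ j"] Suc.prems by (simp add: bit_exp_iff del: power_Suc)
  then show ?case using stable_subspaceD(6)[OF M(1) Suc.prems Suc.IH] Suc.prems by simp
qed

text \<open>The difference of the \<open>A\<close>-components equals the reversed difference of the
  \<open>B\<close>-components and so lies in both subspaces. This turns any identity between sums
  into identities between components.\<close>

lemma direct_sum_unique:
  assumes A: "stable_subspace n A" and B: "stable_subspace n B" and int: "A \<inter> B = {0\<^sub>v (2 ^ n)}"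
    and mem: "u \<in> A" "u' \<in> A" "v \<in> B" "v' \<in> B" and eq: "u + v = u' + v'"
  shows "u = u'" "v = v'"
proof -
  have c: "u \<in> carrier_vec (2 ^ n)" "u' \<in> carrier_vec (2 ^ n)" "v \<in> carrier_vec (2 ^ n)" "v' \<in> carrier_vec (2 ^ n)"
    using mem stable_subspaceD(2) A B by blast+
  have pt: "u $ k + v $ k = u' $ k + v' $ k" if "k < 2 ^ n" for k
    using arg_cong[OF eq, of "\<lambda>w. w $ k"] c that by simp
  have *: "u + (-1) \<cdot>\<^sub>v u' = v' + (-1) \<cdot>\<^sub>v v"
    using c pt by (intro eq_vecI) (auto simp: algebra_simps)
  have "u + (-1) \<cdot>\<^sub>v u' \<in> A" "v' + (-1) \<cdot>\<^sub>v v \<in> B"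
    using mem stable_subspaceD(4,5) A B by blast+
  then have "u + (-1) \<cdot>\<^sub>v u' = 0\<^sub>v (2 ^ n)" using * int by force
  then have "(u + (-1) \<cdot>\<^sub>v u') $ k = 0" if "k < 2 ^ n" for k using that by simp
  then have u: "u $ k = u' $ k" if "k < 2 ^ n" for k using c that by simp
  then show "u = u'" using c by (intro eq_vecI) auto
  show "v = v'" using c pt u by (intro eq_vecI) auto
qed

lemma odd_indecomposable:
  assumes n: "n \<ge> 3" and A: "stable_subspace n A" and B: "stable_subspace n B"
    and sum: "is_direct_sum (2 ^ n) (parity_space n False) A B"
  shows "A = {0\<^sub>v (2 ^ n)} \<or> B = {0\<^sub>v (2 ^ n)}"
proof -
  have int: "A \<inter> B = {0\<^sub>v (2 ^ n)}" using sum by (simp add: is_direct_sum_def)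
  note AW = direct_summand_subset[OF A B sum]
  note unique = direct_sum_unique[OF A B int]
  let ?e = "unit_vec (2 ^ n) 1 :: complex vec"
  \<comment> \<open>A summand containing \<open>?e\<close> contains all basis vectors with a single
    one, hence the low-weight vector of the other summand if that is nonzero.\<close>
  have zero: "N = {0\<^sub>v (2 ^ n)}"
    if e: "?e \<in> M" and M: "stable_subspace n M" and N: "stable_subspace n N" "N \<subseteq> parity_space n False"
      and MN: "M \<inter> N = {0\<^sub>v (2 ^ n)}" for M N
  proof (rule ccontr)
    assume "N \<noteq> {0\<^sub>v (2 ^ n)}"
    then obtain z where z: "z \<in> N" "z \<noteq> 0\<^sub>v (2 ^ n)"
      "\<And>k. k < 2 ^ n \<Longrightarrow> z $ k \<noteq> 0 \<Longrightarrow> k \<in> (\<lambda>j. 2 ^ j) ` {..<n}"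
      using odd_low_weight[OF N(1) _ N(2)] by blast
    have "z \<in> M"
    proof (rule subspace_mem_of_unit_vecs[OF stable_subspaceD(1)[OF M] _ _ _ z(3)])
      show "unit_vec (2 ^ n) k \<in> M" if "k \<in> (\<lambda>j. 2 ^ j) ` {..<n}" for k
        using that unit_power_mem[OF M e] by auto
    qed (use z(1) stable_subspaceD(2)[OF N(1)] in auto)
    then show False using z(1,2) MN by blast
  qed
  \<comment> \<open>The index 7 has ones exactly at bits 0, 1 and 2; lowering at bits 1 and 2 leaves
    the index 1 of \<open>?e\<close>.\<close>
  have less7: "(7::nat) < 2 ^ n"
    using power_increasing[OF n, of "2::nat"] by simp
  have bit7: "bit (7::nat) i \<longleftrightarrow> i < 3" for i
    using bit_mask_iff[of 3 i, where ?'a = nat] by (simp add: mask_eq_exp_minus_1)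
  have wt7: "weight 7 = 3" by (simp add: weight_def bit7)
  have "pair_flip 1 7 = 1"
    by (rule bit_eqI) (auto simp: bit_pair_flip bit7 bit_Suc_0_iff)
  then have low7: "lower_op n 1 (unit_vec (2 ^ n) 7) = ?e"
    using lower_op_unit_vec[of 1 n 7] n less7 by (simp add: bit7 bit_Suc_0_iff)
  have "unit_vec (2 ^ n) 7 \<in> parity_space n False"
    using less7 by (auto simp: parity_space_def unit_vec_def wt7)
  then obtain a b where ab: "unit_vec (2 ^ n) 7 = a + b" "a \<in> A" "b \<in> B"
    using sum unfolding is_direct_sum_def by blast
  define x y where "x = lower_op n 1 a" and "y = lower_op n 1 b"
  have x: "x \<in> A" and y: "y \<in> B"
    using stable_subspaceD(7)[OF A _ ab(2), of 1] stable_subspaceD(7)[OF B _ ab(3), of 1] n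
    by (simp_all add: x_def y_def)
  have xc: "x \<in> carrier_vec (2 ^ n)" and yc: "y \<in> carrier_vec (2 ^ n)"
    by (simp_all add: x_def y_def)
  have "lower_op n 1 (a + b) = x + y"
    unfolding x_def y_def using ab n stable_subspaceD(2) A B by (intro lower_op_add) auto
  then have xy: "x + y = ?e" using low7 ab(1) by simp
  \<comment> \<open>\<open>Z\<close> collects the \<open>A\<close>-components of low-weight vectors.
    It contains \<open>x\<close>, because \<open>x + y\<close> is \<open>?e\<close>. Its members are
    not assumed to have low weight themselves; that follows once all lowerings are seen to kill
    them.\<close>
  define Z where "Z = {u \<in> A. \<exists>v\<in>B. \<forall>k<2 ^ n. (u + v) $ k \<noteq> 0 \<longrightarrow> weight k \<le> 1}"
  have Z: "swap_op n c z \<in> Z \<and> lower_op n c z = 0\<^sub>v (2 ^ n)" if z: "z \<in> Z" and c: "Suc c < n" for z c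
  proof -
    obtain v where v: "z \<in> A" "v \<in> B" "\<And>k. k < 2 ^ n \<Longrightarrow> (z + v) $ k \<noteq> 0 \<Longrightarrow> weight k \<le> 1"
      using z unfolding Z_def by blast
    have cv: "z \<in> carrier_vec (2 ^ n)" "v \<in> carrier_vec (2 ^ n)"
      using v stable_subspaceD(2) A B by blast+
    have "weight k \<le> 1" if k: "k < 2 ^ n" "swap_op n c (z + v) $ k \<noteq> 0" for k
    proof (cases "bit k c = bit k (Suc c)")
      case True
      then have "(z + v) $ k \<noteq> 0" using k by (auto simp: swap_op_index simp del: index_add_vec)
      then show ?thesis using v(3) k(1) by blast
    next
      case False
      then have "(z + v) $ pair_flip c k \<noteq> 0" using k by (simp add: swap_op_index del: index_add_vec)
      then show ?thesis
        using v(3)[of "pair_flip c k"] k(1) c weight_pair_flip_one[OF False] by simp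
    qed
    then have 1: "swap_op n c z \<in> Z"
      unfolding swap_op_add[OF c cv] Z_def
      using stable_subspaceD(6)[OF A c v(1)] stable_subspaceD(6)[OF B c v(2)] by blast
    have "lower_op n c (z + v) $ k = 0" if k: "k < 2 ^ n" for k
    proof (rule ccontr)
      assume nz: "lower_op n c (z + v) $ k \<noteq> 0"
      then have "\<not> bit k c" "\<not> bit k (Suc c)" and "(z + v) $ pair_flip c k \<noteq> 0"
        using k by (simp_all add: lower_op_index del: index_add_vec split: if_splits)
      then show False
        using v(3)[of "pair_flip c k"] k c weight_pair_flip_zero[of k c] by simp
    qed
    then have "lower_op n c (z + v) = 0\<^sub>v (2 ^ n)" by (intro eq_vecI) simp_all
    \<comment> \<open>Zero is split as zero plus zero so that uniqueness of components yields the
      vanishing of the \<open>A\<close>-part alone.\<close>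
    then have "lower_op n c z + lower_op n c v = 0\<^sub>v (2 ^ n) + 0\<^sub>v (2 ^ n)"
      unfolding lower_op_add[OF c cv] by simp
    then have "lower_op n c z = 0\<^sub>v (2 ^ n)"
      using unique(1) stable_subspaceD(3,7) A B c v(1,2) by blast
    with 1 show ?thesis by blast
  qed
  have wt1: "weight (Suc 0) = 1" using weight_power_2[of 0] by simp
  have "\<forall>k<2 ^ n. (x + y) $ k \<noteq> 0 \<longrightarrow> weight k \<le> 1"
    unfolding xy by (auto simp: unit_vec_def wt1)
  then have "x \<in> Z" using x y unfolding Z_def by blast
  then have xw: "weight k \<le> 1" if "k < 2 ^ n" "x $ k \<noteq> 0" for k
    using weight_le_one_of_killed[of Z n x k] Z that by blast
  have x0: "x $ (2 ^ Suc j) = 0" if "Suc j < n" for j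
    using that
  proof (induction j)
    case 0
    \<comment> \<open>The index 2 has bit 1 set, and a vector lowered at bits 1 and 2 has
      coefficient 0 there.\<close>
    then show ?case using n less7 by (simp add: x_def lower_op_index bit_Suc_0_iff)
  next
    case (Suc j)
    let ?j = "Suc j"
    \<comment> \<open>This flip avoids bit 0 and fixes \<open>?e\<close>. By uniqueness it also
      fixes the component \<open>x\<close>, whose coefficients at the two single-one indices it
      exchanges are therefore equal.\<close>
    have "swap_op n ?j ?e = ?e"
      using Suc.prems less7 by (intro swap_op_unit_vec_zero) (auto simp: bit_1_iff)
    then have "swap_op n ?j x + swap_op n ?j y = x + y"
      using swap_op_add[OF Suc.prems xc yc] xy by simp
    then have fixed: "swap_op n ?j x = x"
      using unique(1) x y stable_subspaceD(6) A B Suc.prems by blast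
    have flip: "pair_flip ?j (2 ^ ?j) = 2 ^ Suc ?j"
      by (rule bit_eqI) (auto simp only: bit_pair_flip bit_exp_iff split: if_splits)
    have lt: "(2::nat) ^ ?j < 2 ^ n" using Suc.prems by (intro power_strict_increasing) auto
    have "bit ((2::nat) ^ ?j) ?j" "\<not> bit ((2::nat) ^ ?j) (Suc ?j)"
      unfolding bit_exp_iff by simp_all
    then have "swap_op n ?j x $ (2 ^ ?j) = x $ (2 ^ Suc ?j)"
      using swap_op_index[OF lt, of ?j x] flip by metis
    then show ?case using fixed Suc.IH Suc.prems by simp
  qed
  have xp: "x \<in> parity_space n False" using x AW by blast
  have supp: "k = 1" if k: "k < 2 ^ n" "x $ k \<noteq> 0" for k
  proof -
    have "odd (weight k)" using parity_spaceD(2)[OF xp] k by simp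
    then have "weight k = 1" using xw[OF k] by (cases "weight k = 0") auto
    then obtain j where j: "j < n" "k = 2 ^ j" using weight_one_obtains k(1) by metis
    then show ?thesis using x0 k(2) by (cases j) auto
  qed
  have xe: "x = x $ 1 \<cdot>\<^sub>v ?e"
    using supp xc less7 by (intro eq_vecI) (auto simp: unit_vec_def)
  \<comment> \<open>If the multiple is zero, \<open>?e\<close> is \<open>y\<close> and lies in
    \<open>B\<close>; otherwise it lies in \<open>A\<close>.\<close>
  show ?thesis
  proof (cases "x $ 1 = 0")
    case True
    then have "x = 0\<^sub>v (2 ^ n)" using xe by (intro eq_vecI) auto
    then have "?e = y" using xy yc by simp
    then show ?thesis using zero[OF _ B A AW(1)] y int by (simp add: Int_commute)
  next
    case False
    then have "?e = inverse (x $ 1) \<cdot>\<^sub>v x" using xe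
      by (metis left_inverse one_smult_vec smult_smult_assoc)
    then have "?e \<in> A" using stable_subspaceD(5)[OF A x] by metis
    then show ?thesis using zero[OF _ A B AW(2) int] by simp
  qed
qed

section \<open>Subrepresentations of the mixed doubles group\<close>

text \<open>The generators are involutions, so a formal inverse letter has the class of the letter
  itself, and its image under \<open>\<rho>\<close> is again one of the prescribed matrices.\<close>

lemma md_gen_inverse_class:
  assumes "x \<in> md_gens n"
  shows "word_class (md_gens n) (md_rels n) [(x, e)] = word_class (md_gens n) (md_rels n) [(x, True)]"
proof (cases e)
  case False
  let ?C = "word_cong (md_gens n) (md_rels n)"
  have "([(x, True), (x, True)], []) \<in> md_rels n"
    using assms by (auto simp: md_gens_def intro: md_rels.s_sq[simplified] md_rels.r_sq[simplified])
  then have "([(x, False)] @ [(x, True), (x, True)] @ [], [(x, False)] @ [] @ []) \<in> ?C"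
    using assms by (intro word_cong.rel) auto
  moreover have "([] @ [(x, False), (x, \<not> False)] @ [(x, True)], [] @ [(x, True)]) \<in> ?C"
    using assms by (intro word_cong.cancel) auto
  ultimately have "([(x, False)], [(x, True)]) \<in> ?C"
    by (auto intro: word_cong.trans word_cong.sym)
  with False show ?thesis by (simp add: word_class_eqI)
qed simp

text \<open>Forwards, the images of \<open>md_s n i\<close> and \<open>md_r n i\<close> differ by
  \<open>p - q\<close> times a lowering, which is invertible as a scalar. Backwards, invariance
  passes from the letters to all words, and every group element is the class of a word.\<close>

lemma is_subrepresentation_iff:
  assumes pq: "p \<noteq> q" and rep: "is_md_rep n p q \<rho>"
  shows "is_subrepresentation (MD n) (2 ^ n) \<rho> M \<longleftrightarrow> stable_subspace n M"
proof
  have gen: "\<rho> (md_r n i) = local_op n (braid_mat q) i" "\<rho> (md_s n i) = local_op n (braid_mat p) i"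
    if "i \<in> {1..<n}" for i
    using rep that by (simp_all add: is_md_rep_def)
  {
    assume sub: "is_subrepresentation (MD n) (2 ^ n) \<rho> M"
    then have M: "subspace class_ring M (module_vec TYPE(complex) (2 ^ n))"
      and inv: "\<And>g w. g \<in> carrier (MD n) \<Longrightarrow> w \<in> M \<Longrightarrow> \<rho> g *\<^sub>v w \<in> M"
      by (auto simp: is_subrepresentation_def)
    note S = M[unfolded subspace_vec_iff]
    have "swap_op n b v \<in> M \<and> lower_op n b v \<in> M" if b: "Suc b < n" and v: "v \<in> M" for b v
    proof -
      let ?i = "n - b - 1"
      have i: "?i \<in> {1..<n}" "b = n - ?i - 1" using b by auto
      have "md_s n ?i \<in> carrier (MD n)" "md_r n ?i \<in> carrier (MD n)"
        unfolding md_s_def md_r_def MD_def using i(1)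
        by (intro word_class_carrier; simp add: md_gens_def)+
      then have R: "local_op n (braid_mat q) ?i *\<^sub>v v \<in> M" and S': "local_op n (braid_mat p) ?i *\<^sub>v v \<in> M"
        using inv v gen[OF i(1)] by metis+
      have vc: "v \<in> carrier_vec (2 ^ n)" using v S by blast
      note act = local_op_mult_vec[OF i(1) vc i(2)]
      have "lower_op n b v = inverse (p - q) \<cdot>\<^sub>v
          (local_op n (braid_mat p) ?i *\<^sub>v v + (-1) \<cdot>\<^sub>v (local_op n (braid_mat q) ?i *\<^sub>v v))"
        unfolding act using pq by (intro eq_vecI) (simp_all add: field_simps)
      then have L: "lower_op n b v \<in> M" using R S' S by metis
      \<comment> \<open>With the lowering available, its contribution is subtracted from the action
        of \<open>R\<close>.\<close>
      have "swap_op n b v = local_op n (braid_mat q) ?i *\<^sub>v v + (-q) \<cdot>\<^sub>v lower_op n b v"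
        unfolding act by (intro eq_vecI) simp_all
      then have "swap_op n b v \<in> M" using R L S by metis
      with L show ?thesis by blast
    qed
    with M show "stable_subspace n M" by (simp add: stable_subspace_def)
  next
    assume st: "stable_subspace n M"
    note D = stable_subspaceD[OF st]
    interpret \<rho>: group_hom "MD n" "GL (2 ^ n)" \<rho>
      using rep by (simp add: is_md_rep_def is_representation_def)
    let ?cl = "word_class (md_gens n) (md_rels n)"
    have loc: "local_op n (braid_mat a) i *\<^sub>v v \<in> M" if "i \<in> {1..<n}" "v \<in> M" for a i v
    proof -
      have "v \<in> carrier_vec (2 ^ n)" "Suc (n - i - 1) < n" using that D(2) by auto
      then show ?thesis
        using local_op_mult_vec[OF that(1) _ HOL.refl] D(4-7) that(2) by metis
    qed
    have letter: "\<rho> (?cl [(x, e)]) *\<^sub>v v \<in> M" if x: "x \<in> md_gens n" and v: "v \<in> M" for x e v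
    proof -
      obtain i where i: "i \<in> {1..<n}" "x = Sgen i \<or> x = Rgen i" using x by (auto simp: md_gens_def)
      then have "\<rho> (?cl [(x, True)]) = local_op n (braid_mat p) i \<or>
          \<rho> (?cl [(x, True)]) = local_op n (braid_mat q) i"
        using gen[OF i(1)] by (auto simp: md_s_def md_r_def)
      then show ?thesis using loc[OF i(1) v] md_gen_inverse_class[OF x, of e] by auto
    qed
    have carr: "?cl w \<in> carrier (MD n)" if "w \<in> words (md_gens n)" for w
      using word_class_carrier[OF that] by (simp add: MD_def)
    have mat: "\<rho> g \<in> carrier_mat (2 ^ n) (2 ^ n)" if "g \<in> carrier (MD n)" for g
      using \<rho>.hom_closed[OF that] by (auto simp: units_of_def Units_def ring_mat_simps)
    have word: "\<rho> (?cl w) *\<^sub>v v \<in> M" if "w \<in> words (md_gens n)" "v \<in> M" for w v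
      using that
    proof (induction w)
      case Nil
      have "\<rho> (?cl []) = 1\<^sub>m (2 ^ n)"
        using \<rho>.hom_one by (simp add: MD_def presented_group_one units_of_def ring_mat_simps)
      then show ?case using Nil D(2) by auto
    next
      case (Cons y w)
      obtain x e where y: "y = (x, e)" by force
      have w: "[(x, e)] \<in> words (md_gens n)" "w \<in> words (md_gens n)" using Cons.prems y by auto
      have "?cl (y # w) = ?cl [(x, e)] \<otimes>\<^bsub>MD n\<^esub> ?cl w"
        unfolding MD_def using presented_group_mult[OF w] y by simp
      then have "\<rho> (?cl (y # w)) = \<rho> (?cl [(x, e)]) * \<rho> (?cl w)"
        using \<rho>.hom_mult[OF carr[OF w(1)] carr[OF w(2)]] by (simp add: units_of_def ring_mat_simps)
      then have "\<rho> (?cl (y # w)) *\<^sub>v v = \<rho> (?cl [(x, e)]) *\<^sub>v (\<rho> (?cl w) *\<^sub>v v)"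
        using mat[OF carr[OF w(1)]] mat[OF carr[OF w(2)]] Cons.prems(2) D(2)
        by (simp add: assoc_mult_mat_vec[of _ "2 ^ n" "2 ^ n" _ "2 ^ n"] subset_iff)
      then show ?case using letter Cons.IH[OF w(2) Cons.prems(2)] Cons.prems y by simp
    qed
    show "is_subrepresentation (MD n) (2 ^ n) \<rho> M"
      unfolding is_subrepresentation_def
      using D(1) word by (auto simp: MD_def elim!: presented_group_carrierE)
  }
qed

theorem proposition5p11:
  fixes p q :: complex and n :: nat and \<rho> :: "md_gen word set \<Rightarrow> complex mat"
  assumes "p \<noteq> q" and "n \<ge> 3" and "is_md_rep n p q \<rho>"
  shows "\<exists>U W.
    is_direct_sum (2 ^ n) (carrier_vec (2 ^ n)) U W \<and>
    is_indecomposable (MD n) (2 ^ n) \<rho> U \<and> subspace_dim (2 ^ n) U = 2 ^ (n - 1) \<and>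
    is_indecomposable (MD n) (2 ^ n) \<rho> W \<and> subspace_dim (2 ^ n) W = 2 ^ (n - 1)"
proof (intro exI conjI)
  have sub: "is_subrepresentation (MD n) (2 ^ n) \<rho> M \<longleftrightarrow> stable_subspace n M" for M
    using is_subrepresentation_iff assms by blast
  have nz: "parity_space n c \<noteq> {0\<^sub>v (2 ^ n)}" for c
  proof -
    \<comment> \<open>An index of weight 0 or 1 according to the parity. It must lie below
      \<open>2 ^ n\<close>, since \<open>unit_vec\<close> is the zero vector for an index out of
      range.\<close>
    define k :: nat where "k = (if c then 0 else 2 ^ 0)"
    have "even (weight k) = c"
      using weight_eq_0_iff[of 0] weight_power_2[of 0] by (simp add: k_def)
    then have "unit_vec (2 ^ n) k \<in> parity_space n c" by (auto simp: parity_space_def unit_vec_def)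
    moreover have "k < 2 ^ n" using assms(2) one_less_power[of "2::nat" n] by (simp add: k_def)
    then have "(unit_vec (2 ^ n) k :: complex vec) $ k \<noteq> 0\<^sub>v (2 ^ n) $ k" by simp
    then have "unit_vec (2 ^ n) k \<noteq> (0\<^sub>v (2 ^ n) :: complex vec)" by metis
    ultimately show ?thesis by blast
  qed
  show "is_direct_sum (2 ^ n) (carrier_vec (2 ^ n)) (parity_space n True) (parity_space n False)"
    by (rule parity_space_direct_sum)
  show "is_indecomposable (MD n) (2 ^ n) \<rho> (parity_space n True)"
    unfolding is_indecomposable_def sub using stable_parity_space nz even_indecomposable by blast
  show "is_indecomposable (MD n) (2 ^ n) \<rho> (parity_space n False)"
    unfolding is_indecomposable_def sub
    using stable_parity_space nz odd_indecomposable[OF assms(2)] by blast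
qed (use assms(2) dim_parity_space in auto)

end
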